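(* Let $\mu = k^2\sup_{x\in\Omega}\int_\Omega |G(x,y)|\,dy$ and $\|u_0\|=\|u_0\|_{C(\overline\Omega\times\partial\Omega)}$. For $\gamma>0$ replace $u_0$ by $\gamma u_0$ (equivalently, multiply the boundary sources by $\gamma$). Then the first forward operator $K_1$ is replaced by $\gamma^3K_1$. If its regularized pseudoinverse is correspondingly chosen to be $\gamma^{-3}\mathcal{K}_1$, then the quantity $\frac{81}{8}\mu\,\|\mathcal{K}_1\|\,\|u_0\|^3$ is unchanged by the scaling, and the radius $$r_\gamma=\frac{2}{27\mu\,\|\gamma u_0\|^2}\Big[\sqrt{16C^2+1}-4C\Big],\qquad C=\max\Big\{2,\ \frac{81}{8}\,\mu\,\|\mathcal{K}_1\|\,\|u_0\|^3\Big\},$$ is such that the inverse Born series of the scaled problem converges in $L^\infty(\Omega)$ for all $\phi\in C(\partial\Omega\times\partial\Omega)$ with $\|\gamma^{-3}\mathcal{K}_1\phi\|_\infty<r_\gamma$, and $r_\gamma\to\infty$ as $\gamma\to0$.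
   Context: Setting. $\Omega\subset\mathbb{R}^d$, $d\ge 2$, is a bounded domain with smooth boundary, and $k$ is real such that $-k^2$ is not a Neumann eigenvalue of the Laplacian on $\Omega$. $G$ is the Neumann Green's function: $\Delta_x G(x,y)+k^2G(x,y)=\delta(x-y)$ in $\Omega$ with zero normal derivative on $\partial\Omega$. The nonlinear problem is $\Delta u+k^2u+k^2\beta u^3=0$ in $\Omega$, $\partial u/\partial\nu=g$ on $\partial\Omega$ (here $\partial/\partial\nu$ is the outward normal derivative), with $\beta\in L^\infty(\Omega)$ real valued. A family of real sources $g=g_s$ indexed by $s\in\partial\Omega$ is used; $u_0(\cdot,s)$ is the solution of the linear problem $\Delta u_0+k^2u_0=0$ in $\Omega$, $\partial u_0/\partial\nu=g_s$ on $\partial\Omega$, and $u_0$ is viewed as a function in $C(\overline\Omega\times\partial\Omega)$, not identically zero. Forward operators. For $v\in C(\overline\Omega\times\partial\Omega)$ and $\beta\in L^\infty(\Omega)$ put $b(v,\beta)(x,s)=-k^2\int_\Omega G(x,y)\beta(y)v(y,s)\,dy$. For a multilinear operator $T_l$ of order $l$ (with values in functions of $(x,s)$), $BT_l$ is the multilinear operator of order $l+1$ given by $BT_l(\beta_1,\dots,\beta_{l+1})=b(T_l(\beta_1,\dots,\beta_l),\beta_{l+1})$. For multilinear $T_l,T_j$ of orders $l,j$, $T_l\otimes T_j(\beta_1,\dots,\beta_{l+j})=T_l(\beta_1,\dots,\beta_l)\,T_j(\beta_{l+1},\dots,\beta_{l+j})$ (pointwise product). The operators $K_n$ (multilinear of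 order $n$) are defined by $K_0=u_0$ and, for $n\ge0$, $$K_{n+1}=B\sum_{\substack{i_1+i_2+i_3=n\\ 0\le i_1,i_2,i_3\le n}}K_{i_1}\otimes K_{i_2}\otimes K_{i_3}.$$ After the recursion, $K_n(\beta_1,\dots,\beta_n)$ is restricted to $\partial\Omega\times\partial\Omega$, so $K_n:[L^\infty(\Omega)]^n\to C(\partial\Omega\times\partial\Omega)$. Inverse operators. $\mathcal{K}_1=K_1^+$ is some fixed regularized pseudoinverse of $K_1$, a bounded linear operator $C(\partial\Omega\times\partial\Omega)\to L^\infty(\Omega)$ with operator norm $\|\mathcal{K}_1\|$ (no further property of it is specified). For $m\ge2$, $$\mathcal{K}_m(\phi)=-\sum_{n=2}^m\ \sum_{\substack{i_1+\cdots+i_n=m\\ i_j\ge1}}\mathcal{K}_1K_n\big(\mathcal{K}_{i_1}(\phi),\dots,\mathcal{K}_{i_n}(\phi)\big),$$ and the inverse Born series is $\sum_{m\ge1}\mathcal{K}_m(\phi)$. The inverse Born series of the scaled problem is formed by the same formulas from the forward operators built with $K_0=\gamma u_0$ and with first inverse operator $\gamma^{-3}\mathcal{K}_1$. All $C(\cdot)$ norms are sup norms. *)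

theory Defs
  imports "HOL-Analysis.Analysis" "HOL-Probability.Essential_Supremum"
begin

section \<open>Smooth functions, smooth boundaries, normal derivatives\<close>

text \<open>Intended for open \<open>U\<close>: all iterated directional derivatives of order up to \<open>n\<close> exist and
  are continuous.\<close>

fun Ck_on :: "nat \<Rightarrow> 'a::euclidean_space set \<Rightarrow> ('a \<Rightarrow> real) \<Rightarrow> bool" where
  "Ck_on 0 U f \<longleftrightarrow> continuous_on U f"
| "Ck_on (Suc n) U f \<longleftrightarrow>
     (\<forall>x\<in>U. f differentiable (at x)) \<and> (\<forall>v. Ck_on n U (\<lambda>x. frechet_derivative f (at x) v))"

definition smooth_on :: "'a::euclidean_space set \<Rightarrow> ('a \<Rightarrow> real) \<Rightarrow> bool" where
  "smooth_on U f \<longleftrightarrow> (\<forall>n. Ck_on n U f)"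

text \<open>\<open>f\<close> is differentiable in \<open>U\<close>, and \<open>f\<close> and its gradient extend continuously to \<open>Z \<supseteq> U\<close>.\<close>

definition C1_up_to :: "'a::euclidean_space set \<Rightarrow> 'a set \<Rightarrow> ('a \<Rightarrow> real) \<Rightarrow> bool" where
  "C1_up_to U Z f \<longleftrightarrow> continuous_on Z f \<and>
     (\<exists>D. continuous_on Z D \<and> (\<forall>x\<in>U. (f has_derivative (\<lambda>h. D x \<bullet> h)) (at x)))"

definition laplacian :: "('a::euclidean_space \<Rightarrow> real) \<Rightarrow> 'a \<Rightarrow> real" where
  "laplacian f x =
     (\<Sum>b\<in>Basis. frechet_derivative (\<lambda>y. frechet_derivative f (at y) b) (at x) b)"

definition defining_function ::
  "'a::euclidean_space set \<Rightarrow> 'a \<Rightarrow> 'a set \<Rightarrow> ('a \<Rightarrow> real) \<Rightarrow> bool" where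
  "defining_function \<Omega> p U \<rho> \<longleftrightarrow> open U \<and> p \<in> U \<and> smooth_on U \<rho> \<and>
     (\<forall>x\<in>U. \<exists>v. frechet_derivative \<rho> (at x) v \<noteq> 0) \<and> (\<forall>x\<in>U. x \<in> \<Omega> \<longleftrightarrow> \<rho> x < 0)"

definition smooth_boundary :: "'a::euclidean_space set \<Rightarrow> bool" where
  "smooth_boundary \<Omega> \<longleftrightarrow> (\<forall>p\<in>frontier \<Omega>. \<exists>U \<rho>. defining_function \<Omega> p U \<rho>)"

text \<open>The outward unit normal is the normalised gradient of a defining function.\<close>

definition outward_unit_normal :: "'a::euclidean_space set \<Rightarrow> 'a \<Rightarrow> 'a \<Rightarrow> bool" where
  "outward_unit_normal \<Omega> p \<nu> \<longleftrightarrow> norm \<nu> = 1 \<and>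
     (\<exists>U \<rho> c. defining_function \<Omega> p U \<rho> \<and> c > 0 \<and>
        (\<rho> has_derivative (\<lambda>h. c * (\<nu> \<bullet> h))) (at p))"

text \<open>One-sided, so that only the values of \<open>u\<close> on the closure of \<open>\<Omega>\<close> matter.\<close>

definition has_normal_derivative ::
  "'a::euclidean_space set \<Rightarrow> ('a \<Rightarrow> real) \<Rightarrow> real \<Rightarrow> 'a \<Rightarrow> bool" where
  "has_normal_derivative \<Omega> u c p \<longleftrightarrow> (\<exists>\<nu>. outward_unit_normal \<Omega> p \<nu> \<and>
     ((\<lambda>t. (u p - u (p - t *\<^sub>R \<nu>)) / t) \<longlongrightarrow> c) (at_right 0))"

section \<open>The Neumann problem and its Green's function\<close>

text \<open>\<open>\<Delta>u = \<kappa>u\<close> in \<open>\<Omega>\<close> with \<open>\<partial>u/\<partial>\<nu> = g\<close> on the boundary.\<close>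

definition neumann_solution ::
  "'a::euclidean_space set \<Rightarrow> real \<Rightarrow> ('a \<Rightarrow> real) \<Rightarrow> ('a \<Rightarrow> real) \<Rightarrow> bool" where
  "neumann_solution \<Omega> \<kappa> g u \<longleftrightarrow> Ck_on 2 \<Omega> u \<and> continuous_on (closure \<Omega>) u \<and>
     (\<forall>x\<in>\<Omega>. laplacian u x = \<kappa> * u x) \<and>
     (\<forall>x\<in>frontier \<Omega>. has_normal_derivative \<Omega> u (g x) x)"

definition neumann_eigenvalue :: "'a::euclidean_space set \<Rightarrow> real \<Rightarrow> bool" where
  "neumann_eigenvalue \<Omega> \<kappa> \<longleftrightarrow>
     (\<exists>u. neumann_solution \<Omega> \<kappa> (\<lambda>x. 0) u \<and> C1_up_to \<Omega> (closure \<Omega>) u \<and> (\<exists>x\<in>\<Omega>. u x \<noteq> 0))"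

definition test_function :: "'a::euclidean_space set \<Rightarrow> ('a \<Rightarrow> real) \<Rightarrow> bool" where
  "test_function \<Omega> \<phi> \<longleftrightarrow> smooth_on UNIV \<phi> \<and>
     compact (closure {x. \<phi> x \<noteq> 0}) \<and> closure {x. \<phi> x \<noteq> 0} \<subseteq> \<Omega>"

text \<open>Continuous off the diagonal, with singularity of order less than the dimension.  The Neumann
  Green's function of a bounded smooth domain is of this kind: it is bounded by a multiple of
  \<open>|x - y| powr (2 - d)\<close> for \<open>d \<ge> 3\<close> and of \<open>1 + |ln |x - y||\<close> for \<open>d = 2\<close>.\<close>

definition weakly_singular :: "'a::euclidean_space set \<Rightarrow> ('a \<Rightarrow> 'a \<Rightarrow> real) \<Rightarrow> bool" where
  "weakly_singular \<Omega> G \<longleftrightarrow>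
     continuous_on {(x, y). x \<in> closure \<Omega> \<and> y \<in> \<Omega> \<and> x \<noteq> y} (\<lambda>(x, y). G x y) \<and>
     (\<exists>M \<alpha>. \<alpha> > 0 \<and> (\<forall>x\<in>closure \<Omega>. \<forall>y\<in>\<Omega>. x \<noteq> y \<longrightarrow>
        \<bar>G x y\<bar> \<le> M * dist x y powr (\<alpha> - real DIM('a))))"

text \<open>\<open>\<Delta>\<^sub>x G(x,y) + k\<^sup>2 G(x,y) = \<delta>(x - y)\<close> in the sense of distributions, with zero normal
  derivative in \<open>x\<close>.\<close>

definition neumann_green ::
  "'a::euclidean_space set \<Rightarrow> real \<Rightarrow> ('a \<Rightarrow> 'a \<Rightarrow> real) \<Rightarrow> bool" where
  "neumann_green \<Omega> k G \<longleftrightarrow> weakly_singular \<Omega> G \<and>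
     (\<forall>y\<in>\<Omega>.
        (\<forall>\<phi>. test_function \<Omega> \<phi> \<longrightarrow>
           (LINT x|lebesgue_on \<Omega>. G x y * (laplacian \<phi> x + k\<^sup>2 * \<phi> x)) = \<phi> y) \<and>
        C1_up_to (\<Omega> - {y}) (closure \<Omega> - {y}) (\<lambda>x. G x y) \<and>
        (\<forall>x\<in>frontier \<Omega>. has_normal_derivative \<Omega> (\<lambda>x. G x y) 0 x))"

section \<open>Function spaces\<close>

text \<open>Elements of \<open>C(S \<times> T)\<close> and \<open>L\<^sup>\<infinity>(\<Omega>)\<close> are represented by total functions, of which only the
  values on \<open>S \<times> T\<close>, respectively almost everywhere on \<open>\<Omega>\<close>, matter.\<close>

definition C_space :: "'a::euclidean_space set \<Rightarrow> 'a set \<Rightarrow> ('a \<Rightarrow> 'a \<Rightarrow> real) set" where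
  "C_space S T = {v. continuous_on (S \<times> T) (\<lambda>(x, s). v x s)}"

definition sup_norm :: "'a::euclidean_space set \<Rightarrow> 'a set \<Rightarrow> ('a \<Rightarrow> 'a \<Rightarrow> real) \<Rightarrow> real" where
  "sup_norm S T v = (SUP (x, s)\<in>S \<times> T. \<bar>v x s\<bar>)"

definition Linf :: "'a::euclidean_space set \<Rightarrow> ('a \<Rightarrow> real) set" where
  "Linf \<Omega> = {\<beta>. \<beta> \<in> borel_measurable (lebesgue_on \<Omega>) \<and>
     esssup (lebesgue_on \<Omega>) (\<lambda>y. ereal \<bar>\<beta> y\<bar>) < \<infinity>}"

text \<open>Meaningful on \<^const>\<open>Linf\<close> only, since \<open>real_of_ereal \<infinity> = 0\<close>.\<close>

definition Linf_norm :: "'a::euclidean_space set \<Rightarrow> ('a \<Rightarrow> real) \<Rightarrow> real" where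
  "Linf_norm \<Omega> \<beta> = real_of_ereal (esssup (lebesgue_on \<Omega>) (\<lambda>y. ereal \<bar>\<beta> y\<bar>))"

text \<open>Bounded linear operators \<open>C(\<partial>\<Omega> \<times> \<partial>\<Omega>) \<rightarrow> L\<^sup>\<infinity>(\<Omega>)\<close>.  Linearity and the bound together imply
  that \<open>A \<phi>\<close> depends, up to null sets, only on the restriction of \<open>\<phi>\<close> to \<open>\<partial>\<Omega> \<times> \<partial>\<Omega>\<close>.\<close>

definition bounded_linear_C_Linf ::
  "'a::euclidean_space set \<Rightarrow> (('a \<Rightarrow> 'a \<Rightarrow> real) \<Rightarrow> 'a \<Rightarrow> real) \<Rightarrow> bool" where
  "bounded_linear_C_Linf \<Omega> A \<longleftrightarrow>
     (\<forall>\<phi>\<in>C_space (frontier \<Omega>) (frontier \<Omega>). A \<phi> \<in> Linf \<Omega>) \<and>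
     (\<forall>\<phi>\<in>C_space (frontier \<Omega>) (frontier \<Omega>). \<forall>\<psi>\<in>C_space (frontier \<Omega>) (frontier \<Omega>).
        AE y in lebesgue_on \<Omega>. A (\<lambda>x s. \<phi> x s + \<psi> x s) y = A \<phi> y + A \<psi> y) \<and>
     (\<forall>\<phi>\<in>C_space (frontier \<Omega>) (frontier \<Omega>). \<forall>c.
        AE y in lebesgue_on \<Omega>. A (\<lambda>x s. c * \<phi> x s) y = c * A \<phi> y) \<and>
     (\<exists>B. \<forall>\<phi>\<in>C_space (frontier \<Omega>) (frontier \<Omega>).
        Linf_norm \<Omega> (A \<phi>) \<le> B * sup_norm (frontier \<Omega>) (frontier \<Omega>) \<phi>)"

definition op_norm ::
  "'a::euclidean_space set \<Rightarrow> (('a \<Rightarrow> 'a \<Rightarrow> real) \<Rightarrow> 'a \<Rightarrow> real) \<Rightarrow> real" where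
  "op_norm \<Omega> A =
     (SUP \<phi>\<in>{\<phi> \<in> C_space (frontier \<Omega>) (frontier \<Omega>).
                sup_norm (frontier \<Omega>) (frontier \<Omega>) \<phi> \<le> 1}. Linf_norm \<Omega> (A \<phi>))"

definition series_converges_Linf :: "'a::euclidean_space set \<Rightarrow> (nat \<Rightarrow> 'a \<Rightarrow> real) \<Rightarrow> bool" where
  "series_converges_Linf \<Omega> f \<longleftrightarrow> (\<forall>m\<ge>1. f m \<in> Linf \<Omega>) \<and>
     (\<exists>\<beta>\<in>Linf \<Omega>. (\<lambda>N. Linf_norm \<Omega> (\<lambda>y. (\<Sum>m=1..N. f m y) - \<beta> y)) \<longlonglongrightarrow> 0)"

section \<open>Forward and inverse operators\<close>

text \<open>A multilinear operator of order \<open>l\<close> is a function of a list of \<open>l\<close> coefficients.\<close>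

type_synonym 'a mult_op = "('a \<Rightarrow> real) list \<Rightarrow> 'a \<Rightarrow> 'a \<Rightarrow> real"

definition b_op :: "'a::euclidean_space set \<Rightarrow> real \<Rightarrow> ('a \<Rightarrow> 'a \<Rightarrow> real) \<Rightarrow>
    ('a \<Rightarrow> 'a \<Rightarrow> real) \<Rightarrow> ('a \<Rightarrow> real) \<Rightarrow> 'a \<Rightarrow> 'a \<Rightarrow> real" where
  "b_op \<Omega> k G v \<beta> x s = - (k\<^sup>2) * (LINT y|lebesgue_on \<Omega>. G x y * \<beta> y * v y s)"

definition B_op :: "'a::euclidean_space set \<Rightarrow> real \<Rightarrow> ('a \<Rightarrow> 'a \<Rightarrow> real) \<Rightarrow>
    'a mult_op \<Rightarrow> 'a mult_op" where
  "B_op \<Omega> k G T \<beta>s = b_op \<Omega> k G (T (butlast \<beta>s)) (last \<beta>s)"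

text \<open>\<open>tensor_op l T S\<close> is \<open>T \<otimes> S\<close> for \<open>T\<close> of order \<open>l\<close>.\<close>

definition tensor_op :: "nat \<Rightarrow> 'a mult_op \<Rightarrow> 'a mult_op \<Rightarrow> 'a mult_op" where
  "tensor_op l T S \<beta>s x s = T (take l \<beta>s) x s * S (drop l \<beta>s) x s"

function forward_op :: "'a::euclidean_space set \<Rightarrow> real \<Rightarrow> ('a \<Rightarrow> 'a \<Rightarrow> real) \<Rightarrow>
    ('a \<Rightarrow> 'a \<Rightarrow> real) \<Rightarrow> nat \<Rightarrow> 'a mult_op" where
  "forward_op \<Omega> k G u\<^sub>0 0 = (\<lambda>\<beta>s. u\<^sub>0)"
| "forward_op \<Omega> k G u\<^sub>0 (Suc n) = B_op \<Omega> k G (\<lambda>\<beta>s x s.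
     \<Sum>(i, j, l)\<in>{(i, j, l). i + j + l = n}.
       tensor_op i (forward_op \<Omega> k G u\<^sub>0 i)
         (tensor_op j (forward_op \<Omega> k G u\<^sub>0 j) (forward_op \<Omega> k G u\<^sub>0 l)) \<beta>s x s)"
  by pat_completeness auto
termination by (relation "Wellfounded.measure (\<lambda>(_, _, _, _, n). n)") auto

definition compositions :: "nat \<Rightarrow> nat \<Rightarrow> nat list set" where
  "compositions n m = {is. length is = n \<and> sum_list is = m \<and> (\<forall>i\<in>set is. 1 \<le> i)}"

lemma compositions_less:
  assumes "is \<in> compositions n m" "2 \<le> n" "i \<in> set is"
  shows "i < m"
proof -
  obtain ys zs where eq: "is = ys @ i # zs" using assms(3) by (meson split_list)
  have ys: "\<And>y. y \<in> set ys \<Longrightarrow> 1 \<le> y" and zs: "\<And>z. z \<in> set zs \<Longrightarrow> 1 \<le> z"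
    using assms(1) by (auto simp: compositions_def eq)
  have "length ys \<le> sum_list ys" using ys by (induction ys) force+
  moreover have "length zs \<le> sum_list zs" using zs by (induction zs) force+
  moreover have "length ys + length zs \<ge> 1" "sum_list ys + i + sum_list zs = m"
    using assms(1,2) by (auto simp: compositions_def eq)
  ultimately show ?thesis by linarith
qed

text \<open>The inverse operators determined by forward operators \<open>K\<close> and the first inverse operator
  \<open>A\<close>; the value at \<open>m = 0\<close> is a dummy.\<close>

function inverse_op :: "(nat \<Rightarrow> 'a mult_op) \<Rightarrow> (('a \<Rightarrow> 'a \<Rightarrow> real) \<Rightarrow> 'a \<Rightarrow> real) \<Rightarrow> nat \<Rightarrow>
    ('a \<Rightarrow> 'a \<Rightarrow> real) \<Rightarrow> 'a \<Rightarrow> real" where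
  "inverse_op K A m \<phi> =
     (if m = 0 then (\<lambda>y. 0)
      else if m = 1 then A \<phi>
      else (\<lambda>y. - (\<Sum>n\<in>{2..m}. \<Sum>is\<in>compositions n m.
                     A (K n (map (\<lambda>i. inverse_op K A i \<phi>) is)) y)))"
  by pat_completeness auto
termination
  by (relation "Wellfounded.measure (\<lambda>(_, _, m, _). m)") (auto intro: compositions_less)

end

theory Submission
  imports Defs
begin

text \<open>
  Write \<open>U\<close> for the sup norm of the background field that enters the forward recursion, \<open>\<kappa>\<close> for
  \<open>27/4 \<mu> U\<^sup>2\<close> and \<open>\<nu>\<close> for \<open>3/2 U\<close>.

  The forward operator of order \<open>n\<close> is a sum over ternary trees with \<open>n\<close> inner vertices, and each
  tree contributes at most \<open>\<mu>^n U^(2n+1)\<close> times the product of the norms of its arguments.  The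
  number of such trees is at most \<open>3/2 (27/4)^n\<close> (\<open>ternary_count_bound\<close>), whence the geometric bound
  \<open>\<nu> \<kappa>^n\<close> on the operators (\<open>forward_op_geometric\<close>).  Making sense of this needs the volume potential
  of a weakly singular kernel to be continuous up to the boundary: a pseudoinverse is only controlled
  on continuous data, and the supremum that defines \<open>\<mu>\<close> runs over the open domain only
  (\<open>b_op_C_space\<close>, \<open>b_op_bound\<close>).

  Let \<open>w\<close> be \<open>\<kappa>\<close> times the sum of the norms of the first \<open>N\<close> terms of the inverse series, \<open>x\<close> the
  norm of its first term, and \<open>M = \<parallel>\<K>\<^sub>1\<parallel> \<nu> \<kappa>\<close>.  Summing the recursion over all compositions
  bounds the corresponding quantity for \<open>N + 1\<close> terms by \<open>\<kappa> x + M w\<^sup>2 / (1 - w)\<close>.  For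
  \<open>\<kappa> x \<le> 1/(16 C)\<close>, which the stated radius guarantees, this map sends the interval from \<open>0\<close> to
  \<open>1/(8 C)\<close> into itself (\<open>majorant_invariant\<close>).  The partial sums of the norms therefore stay bounded
  and the series converges absolutely (\<open>inverse_series_converges\<close>).

  The constant \<open>81/8 = 3/2 \<cdot> 27/4\<close> is the one in \<open>M\<close>.  Scaling the field by \<open>\<gamma>\<close> multiplies \<open>U^3\<close>
  by \<open>\<gamma>^3\<close> and the norm of the pseudoinverse by \<open>\<gamma>^-3\<close>, so \<open>C\<close> does not move, while
  \<open>\<kappa>\<close> scales like \<open>\<gamma>\<^sup>2\<close>.  Hence the radius is a constant times \<open>\<gamma>^-2\<close>.  That constant is positive
  because \<open>\<mu>\<close> is: constants are Neumann eigenfunctions, so \<open>k \<noteq> 0\<close>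
  (\<open>neumann_eigenvalue_0\<close>), and a kernel that vanishes off the diagonal cannot reproduce a nonzero
  test function (\<open>kernel_L1_pos\<close>).
\<close>

section \<open>Smooth functions, Neumann solutions and test functions\<close>

lemma frechet_derivative_cong_open:
  fixes f g :: "'a::euclidean_space \<Rightarrow> real"
  assumes "open U" "x \<in> U" "\<And>y. y \<in> U \<Longrightarrow> f y = g y"
  shows "frechet_derivative f (at x) = frechet_derivative g (at x)"
proof -
  have "(f has_derivative D) (at x) \<longleftrightarrow> (g has_derivative D) (at x)" for D
    using assms by (metis has_derivative_transform_within_open)
  then show ?thesis by (simp add: frechet_derivative_def)
qed

text \<open>\<^const>\<open>frechet_derivative\<close> is an arbitrary choice at points where the function is not
  differentiable, so the usual rules for derivatives are available on the open set only.  This lemma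
  lets them be used there without knowing anything about the values outside.\<close>

lemma Ck_on_cong:
  fixes f g :: "'a::euclidean_space \<Rightarrow> real"
  assumes "open U" "\<And>x. x \<in> U \<Longrightarrow> f x = g x" "Ck_on n U f"
  shows "Ck_on n U g"
  using assms(2,3)
proof (induction n arbitrary: f g)
  case 0
  then show ?case using continuous_on_cong by (metis Ck_on.simps(1))
next
  case (Suc n)
  have "g differentiable (at x)" if "x \<in> U" for x
    using Suc.prems assms(1) that unfolding differentiable_def Ck_on.simps
    by (metis has_derivative_transform_within_open)
  moreover have "Ck_on n U (\<lambda>x. frechet_derivative g (at x) v)" for v
    using Suc.IH[of "\<lambda>x. frechet_derivative f (at x) v" "\<lambda>x. frechet_derivative g (at x) v"]
      frechet_derivative_cong_open[OF assms(1) _ Suc.prems(1)] Suc.prems(2) by auto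
  ultimately show ?case by simp
qed

lemma Ck_on_const: "Ck_on n U (\<lambda>x::'a::euclidean_space. c)"
  by (induction n arbitrary: c) auto

lemma Ck_on_Suc_imp: "Ck_on (Suc n) U f \<Longrightarrow> Ck_on n U f"
proof (induction n arbitrary: f)
  case 0
  then show ?case
    by (auto intro!: continuous_at_imp_continuous_on differentiable_imp_continuous_within)
next
  case (Suc n)
  then show ?case by (metis Ck_on.simps(2))
qed

lemma Ck_on_add:
  assumes "open U" "Ck_on n U f" "Ck_on n U g"
  shows "Ck_on n U (\<lambda>x. f x + g x)"
  using assms(2,3)
proof (induction n arbitrary: f g)
  case 0
  then show ?case by (auto intro: continuous_intros)
next
  case (Suc n)
  have "Ck_on n U (\<lambda>x. frechet_derivative (\<lambda>x. f x + g x) (at x) v)" for v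
  proof (rule Ck_on_cong[OF assms(1)])
    show "Ck_on n U (\<lambda>x. frechet_derivative f (at x) v + frechet_derivative g (at x) v)"
      using Suc by simp
    show "frechet_derivative f (at x) v + frechet_derivative g (at x) v
        = frechet_derivative (\<lambda>x. f x + g x) (at x) v" if "x \<in> U" for x
      using Suc.prems that by (subst frechet_derivative_at[symmetric, OF has_derivative_add])
        (auto simp: frechet_derivative_works[symmetric])
  qed
  then show ?case using Suc.prems by auto
qed

lemma Ck_on_mult:
  assumes "open U" "Ck_on n U f" "Ck_on n U g"
  shows "Ck_on n U (\<lambda>x. f x * g x)"
  using assms(2,3)
proof (induction n arbitrary: f g)
  case 0
  then show ?case by (auto intro: continuous_intros)
next
  case (Suc n)
  have "Ck_on n U (\<lambda>x. frechet_derivative (\<lambda>x. f x * g x) (at x) v)" for v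
  proof (rule Ck_on_cong[OF assms(1)])
    show "Ck_on n U (\<lambda>x. f x * frechet_derivative g (at x) v + frechet_derivative f (at x) v * g x)"
      using Suc by (intro Ck_on_add[OF assms(1)] Suc.IH) (auto dest: Ck_on_Suc_imp simp del: Ck_on.simps, auto)
    show "f x * frechet_derivative g (at x) v + frechet_derivative f (at x) v * g x
        = frechet_derivative (\<lambda>x. f x * g x) (at x) v" if "x \<in> U" for x
      using Suc.prems that by (subst frechet_derivative_at[symmetric, OF has_derivative_mult])
        (auto simp: frechet_derivative_works[symmetric])
  qed
  then show ?case using Suc.prems by auto
qed

lemma frechet_derivative_cmult:
  fixes f :: "'a::euclidean_space \<Rightarrow> real"
  assumes "f differentiable (at x)"
  shows "frechet_derivative (\<lambda>x. c * f x) (at x) v = c * frechet_derivative f (at x) v"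
  using assms by (subst frechet_derivative_at[symmetric, OF has_derivative_mult_right])
        (auto simp: frechet_derivative_works[symmetric])

lemma neumann_solution_scale:
  assumes "open \<Omega>" and u: "neumann_solution \<Omega> \<kappa> g u"
  shows "neumann_solution \<Omega> \<kappa> (\<lambda>x. \<gamma> * g x) (\<lambda>x. \<gamma> * u x)"
proof -
  have C2: "Ck_on (Suc (Suc 0)) \<Omega> u" using u by (simp add: neumann_solution_def numeral_2_eq_2)
  have lap: "laplacian (\<lambda>x. \<gamma> * u x) x = \<gamma> * laplacian u x" if x: "x \<in> \<Omega>" for x
  proof -
    have "frechet_derivative (\<lambda>y. frechet_derivative (\<lambda>x. \<gamma> * u x) (at y) b) (at x) b
        = \<gamma> * frechet_derivative (\<lambda>y. frechet_derivative u (at y) b) (at x) b" for b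
    proof -
      have "frechet_derivative (\<lambda>y. frechet_derivative (\<lambda>x. \<gamma> * u x) (at y) b) (at x)
          = frechet_derivative (\<lambda>y. \<gamma> * frechet_derivative u (at y) b) (at x)"
        using C2 by (intro frechet_derivative_cong_open[OF assms(1) x] frechet_derivative_cmult) auto
      then show ?thesis using C2 x by (simp add: frechet_derivative_cmult)
    qed
    then show ?thesis by (simp add: laplacian_def sum_distrib_left)
  qed
  have nd: "has_normal_derivative \<Omega> (\<lambda>x. \<gamma> * u x) (\<gamma> * g x) x"
    if nu: "has_normal_derivative \<Omega> u (g x) x" for x
  proof -
    obtain \<nu> where \<nu>: "outward_unit_normal \<Omega> x \<nu>"
      "((\<lambda>t. (u x - u (x - t *\<^sub>R \<nu>)) / t) \<longlongrightarrow> g x) (at_right 0)"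
      using nu by (auto simp: has_normal_derivative_def)
    have "((\<lambda>t. (\<gamma> * u x - \<gamma> * u (x - t *\<^sub>R \<nu>)) / t) \<longlongrightarrow> \<gamma> * g x) (at_right 0)"
      using tendsto_mult_left[OF \<nu>(2), of \<gamma>] by (simp add: algebra_simps diff_divide_distrib)
    then show ?thesis using \<nu>(1) by (auto simp: has_normal_derivative_def)
  qed
  show ?thesis
    using u lap nd Ck_on_mult[OF assms(1) Ck_on_const, of 2 u \<gamma>]
    by (auto simp: neumann_solution_def intro!: continuous_intros)
qed

text \<open>The derivative of a defining function is a nonzero linear functional; the vector that
  represents it, normalised, is the normal.\<close>

lemma smooth_boundary_normal:
  fixes \<Omega> :: "'a::euclidean_space set"
  assumes "smooth_boundary \<Omega>" "p \<in> frontier \<Omega>"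
  shows "\<exists>\<nu>. outward_unit_normal \<Omega> p \<nu>"
proof -
  obtain U \<rho> where df: "defining_function \<Omega> p U \<rho>"
    using assms by (auto simp: smooth_boundary_def)
  then have pU: "p \<in> U" and "Ck_on (Suc 0) U \<rho>"
    by (auto simp: defining_function_def smooth_on_def simp del: Ck_on.simps)
  then have diff: "\<rho> differentiable (at p)" by auto
  define f where "f = frechet_derivative \<rho> (at p)"
  define D where "D = (\<Sum>b\<in>Basis. f b *\<^sub>R b)"
  have f: "(\<rho> has_derivative f) (at p)" using diff frechet_derivative_works f_def by auto
  have fD: "f h = D \<bullet> h" for h
  proof -
    have "linear f" using f has_derivative_linear by auto
    then have "f h = (\<Sum>b\<in>Basis. (h \<bullet> b) *\<^sub>R f b)"
      using Linear_Algebra.linear_componentwise[of f h 1] by (simp add: linear_componentwise)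
    also have "\<dots> = D \<bullet> h"
      unfolding D_def inner_sum_left by (simp add: inner_commute mult.commute)
    finally show ?thesis .
  qed
  have "D \<noteq> 0" using df pU fD by (auto simp: defining_function_def f_def)
  moreover have "f = (\<lambda>h. norm D * ((D /\<^sub>R norm D) \<bullet> h))" using \<open>D \<noteq> 0\<close> fD by auto
  ultimately have "outward_unit_normal \<Omega> p (D /\<^sub>R norm D)"
    unfolding outward_unit_normal_def using f df
    by (intro conjI exI[of _ U] exI[of _ \<rho>] exI[of _ "norm D"]) auto
  then show ?thesis ..
qed

text \<open>The constants are eigenfunctions.\<close>

lemma neumann_eigenvalue_0:
  assumes "\<Omega> \<noteq> {}" "smooth_boundary \<Omega>"
  shows "neumann_eigenvalue \<Omega> 0"
proof -
  have "has_normal_derivative \<Omega> (\<lambda>x. 1) 0 p" if "p \<in> frontier \<Omega>" for p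
    using smooth_boundary_normal[OF assms(2) that] by (auto simp: has_normal_derivative_def)
  then have "neumann_solution \<Omega> 0 (\<lambda>x. 0) (\<lambda>x. 1)"
    by (auto simp: neumann_solution_def Ck_on_const laplacian_def)
  moreover have "C1_up_to \<Omega> (closure \<Omega>) (\<lambda>x. 1)"
    by (auto simp: C1_up_to_def inner_zero_left[abs_def] intro!: exI[of _ "\<lambda>x. 0"])
  ultimately show ?thesis
    using assms(1) unfolding neumann_eigenvalue_def by (intro exI[of _ "\<lambda>x. 1"]) auto
qed

text \<open>For \<open>n = 0\<close> this is the standard smooth function that is flat at the origin.  The powers of
  \<open>t\<close> in the denominator make the family closed, up to linear combinations, under differentiation.\<close>

definition flat_exp :: "nat \<Rightarrow> real \<Rightarrow> real" where
  "flat_exp n t = (if t > 0 then exp (- 1 / t) / t ^ n else 0)"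

lemma flat_exp_over_t: "(\<lambda>t. flat_exp n t / t) = flat_exp (Suc n)"
  by (auto simp: flat_exp_def fun_eq_iff field_simps)

lemma flat_exp_tendsto_0: "(flat_exp n \<longlongrightarrow> 0) (at 0)"
proof (rule filterlim_split_at)
  have "eventually (\<lambda>t::real. 0 = flat_exp n t) (at_left 0)"
    unfolding eventually_at_left_field by (auto simp: flat_exp_def intro!: exI[of _ "-1"])
  then show "(flat_exp n \<longlongrightarrow> 0) (at_left 0)"
    by (rule Lim_transform_eventually[OF tendsto_const])
  have "((\<lambda>x::real. x ^ n / exp x) \<longlongrightarrow> 0) at_top" by (rule tendsto_power_div_exp_0)
  then have "((\<lambda>t::real. inverse t ^ n / exp (inverse t)) \<longlongrightarrow> 0) (at_right 0)"
    by (rule filterlim_compose[OF _ filterlim_inverse_at_top_right])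
  moreover have "eventually (\<lambda>t::real. inverse t ^ n / exp (inverse t) = flat_exp n t) (at_right 0)"
    unfolding eventually_at_right_field
    by (auto simp: flat_exp_def exp_minus field_simps power_divide intro!: exI[of _ 1])
  ultimately show "(flat_exp n \<longlongrightarrow> 0) (at_right 0)"
    by (rule Lim_transform_eventually)
qed

lemma flat_exp_deriv:
  "(flat_exp n has_real_derivative (flat_exp (n + 2) t - real n * flat_exp (n + 1) t)) (at t)"
proof -
  consider "t > 0" | "t = 0" | "t < 0" by linarith
  then show ?thesis
  proof cases
    case 1
    have pow: "real n * t ^ (n - Suc 0) * t = real n * t ^ n" by (cases n) auto
    have "((\<lambda>t. exp (- 1 / t) / t ^ n) has_real_derivative
        (exp (- 1 / t) * (1 / t\<^sup>2) * t ^ n - exp (- 1 / t) * (real n * t ^ (n - Suc 0))) / (t ^ n * t ^ n)) (at t)"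
      using 1 by (auto intro!: derivative_eq_intros simp: power2_eq_square)
    also have "(exp (- 1 / t) * (1 / t\<^sup>2) * t ^ n - exp (- 1 / t) * (real n * t ^ (n - Suc 0))) / (t ^ n * t ^ n)
        = flat_exp (n + 2) t - real n * flat_exp (n + 1) t"
      using 1 pow by (simp add: flat_exp_def divide_simps power2_eq_square) (auto simp: algebra_simps)
    finally have "((\<lambda>t. exp (- 1 / t) / t ^ n) has_real_derivative
        flat_exp (n + 2) t - real n * flat_exp (n + 1) t) (at t)" .
    then show ?thesis
      using 1 by (rule_tac has_field_derivative_transform_within_open[of _ _ _ "{0<..}"])
        (auto simp: flat_exp_def)
  next
    case 2
    have "(flat_exp n has_real_derivative 0) (at 0)"
      unfolding has_field_derivative_iff
      using flat_exp_tendsto_0[of "Suc n"] by (simp add: flat_exp_def[of n 0] flat_exp_over_t)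
    then show ?thesis using 2 by (simp add: flat_exp_def)
  next
    case 3
    have "((\<lambda>t. 0) has_real_derivative 0) (at t)" by simp
    then show ?thesis
      using 3 by (rule_tac has_field_derivative_transform_within_open[of "\<lambda>t. 0" _ _ "{..<0}"])
        (auto simp: flat_exp_def)
  qed
qed

lemma Ck_on_inner: "Ck_on n UNIV (\<lambda>x::'a::euclidean_space. a + (x - p) \<bullet> v)"
proof (cases n)
  case (Suc m)
  have d: "((\<lambda>x::'a. a + (x - p) \<bullet> v) has_derivative (\<lambda>h. h \<bullet> v)) (at x)" for x
    by (auto intro!: derivative_eq_intros)
  have "frechet_derivative (\<lambda>x::'a. a + (x - p) \<bullet> v) (at x) = (\<lambda>h. h \<bullet> v)" for x
    using frechet_derivative_at[OF d] by simp
  then show ?thesis using d Suc by (auto simp: differentiable_def Ck_on_const)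
qed (auto intro!: continuous_intros)

text \<open>A directional derivative of a member of this family is an affine function times a linear
  combination of two other members, so the induction on the order of smoothness has to treat all
  members at once.\<close>

lemma Ck_on_flat_exp:
  fixes p :: "'a::euclidean_space"
  shows "Ck_on m UNIV (\<lambda>x. flat_exp n (r\<^sup>2 - (x - p) \<bullet> (x - p)))"
proof (induction m arbitrary: n)
  case 0
  have "isCont (flat_exp n) t" for t using flat_exp_deriv DERIV_isCont by blast
  then have "continuous_on UNIV (flat_exp n)" by (simp add: continuous_at_imp_continuous_on)
  then show ?case by (auto intro!: continuous_on_compose2[of UNIV "flat_exp n"] continuous_intros)
next
  case (Suc m)
  let ?\<rho> = "\<lambda>x::'a. r\<^sup>2 - (x - p) \<bullet> (x - p)"
  let ?D = "\<lambda>x. flat_exp (n + 2) (?\<rho> x) - real n * flat_exp (n + 1) (?\<rho> x)"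
  have d\<rho>: "(?\<rho> has_derivative (\<lambda>h. - 2 * ((x - p) \<bullet> h))) (at x)" for x
    by (auto intro!: derivative_eq_intros simp: inner_commute)
  have d: "((\<lambda>x. flat_exp n (?\<rho> x)) has_derivative (\<lambda>h. ?D x * (- 2 * ((x - p) \<bullet> h)))) (at x)" for x
    using has_derivative_compose[OF d\<rho>, of "flat_exp n" "(*) (?D x)"] flat_exp_deriv[of n "?\<rho> x"]
    by (simp add: has_field_derivative_def)
  have eq: "frechet_derivative (\<lambda>x. flat_exp n (?\<rho> x)) (at x) v
      = (flat_exp (n + 2) (?\<rho> x) + - real n * flat_exp (n + 1) (?\<rho> x))
          * (- 2 * (0 + (x - p) \<bullet> v))" for x v
    using frechet_derivative_at[OF d, of x, symmetric] by simp
  have "Ck_on m UNIV (\<lambda>x. frechet_derivative (\<lambda>x. flat_exp n (?\<rho> x)) (at x) v)" for v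
    unfolding eq by (intro Ck_on_mult Ck_on_add Ck_on_const Ck_on_inner open_UNIV Suc.IH)
  then show ?case using d by (auto simp: differentiable_def)
qed

lemma test_function_exists:
  fixes \<Omega> :: "'a::euclidean_space set"
  assumes "open \<Omega>" "p \<in> \<Omega>"
  shows "\<exists>\<phi>. test_function \<Omega> \<phi> \<and> \<phi> p \<noteq> 0"
proof -
  obtain r where r: "r > 0" "cball p r \<subseteq> \<Omega>" using assms open_contains_cball by blast
  define \<phi> where "\<phi> = (\<lambda>x. flat_exp 0 (r\<^sup>2 - (x - p) \<bullet> (x - p)))"
  have "norm (x - p) \<le> r" if "\<phi> x \<noteq> 0" for x
  proof -
    have "(norm (x - p))\<^sup>2 < r\<^sup>2"
      using that by (auto simp: \<phi>_def flat_exp_def power2_norm_eq_inner split: if_splits)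
    then show ?thesis using r(1) by (smt (verit) power2_less_imp_less)
  qed
  then have "{x. \<phi> x \<noteq> 0} \<subseteq> cball p r" by (auto simp: dist_norm norm_minus_commute)
  then have cl: "closure {x. \<phi> x \<noteq> 0} \<subseteq> cball p r" by (simp add: closure_minimal)
  then have "compact (closure {x. \<phi> x \<noteq> 0})"
    by (meson bounded_cball bounded_subset closed_closure compact_eq_bounded_closed)
  moreover have "\<phi> p \<noteq> 0" using r by (simp add: \<phi>_def flat_exp_def)
  moreover have "smooth_on UNIV \<phi>" unfolding smooth_on_def \<phi>_def using Ck_on_flat_exp by blast
  ultimately show ?thesis using cl r by (auto simp: test_function_def)
qed

section \<open>Norms of continuous and of essentially bounded functions\<close>

lemma cSUP_mult_left:
  fixes f :: "'b \<Rightarrow> real"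
  assumes "c > 0" "S \<noteq> {}" "bdd_above (f ` S)"
  shows "(SUP x\<in>S. c * f x) = c * (SUP x\<in>S. f x)"
proof (rule antisym)
  show "(SUP x\<in>S. c * f x) \<le> c * (SUP x\<in>S. f x)"
    using assms by (intro cSUP_least mult_left_mono cSUP_upper) auto
  obtain M where "\<And>x. x \<in> S \<Longrightarrow> f x \<le> M" using assms by (auto simp: bdd_above_def)
  then have "bdd_above ((\<lambda>x. c * f x) ` S)"
    using assms by (intro bdd_aboveI[of _ "c * M"]) auto
  then have "f x \<le> (SUP x\<in>S. c * f x) / c" if "x \<in> S" for x
    using assms cSUP_upper[OF that, of "\<lambda>x. c * f x"] by (simp add: field_simps)
  then have "(SUP x\<in>S. f x) \<le> (SUP x\<in>S. c * f x) / c"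
    using assms by (intro cSUP_least)
  then show "c * (SUP x\<in>S. f x) \<le> (SUP x\<in>S. c * f x)"
    using assms by (simp add: field_simps)
qed

lemma sup_norm_bdd:
  assumes "compact S" "compact T" "v \<in> C_space S T"
  shows "bdd_above ((\<lambda>(x, s). \<bar>v x s\<bar>) ` (S \<times> T))"
proof -
  have "continuous_on (S \<times> T) (\<lambda>(x, s). \<bar>v x s\<bar>)"
    using assms(3) by (auto simp: C_space_def case_prod_unfold intro: continuous_intros)
  then have "compact ((\<lambda>(x, s). \<bar>v x s\<bar>) ` (S \<times> T))"
    using assms by (intro compact_continuous_image compact_Times)
  then show ?thesis by (intro bounded_imp_bdd_above compact_imp_bounded)
qed

lemma sup_norm_upper:
  assumes "compact S" "compact T" "v \<in> C_space S T" "x \<in> S" "s \<in> T"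
  shows "\<bar>v x s\<bar> \<le> sup_norm S T v"
proof -
  have "(x, s) \<in> S \<times> T" using assms(4,5) by simp
  from cSUP_upper[OF this sup_norm_bdd[OF assms(1-3)]] show ?thesis by (simp add: sup_norm_def)
qed

lemma sup_norm_least:
  assumes "S \<noteq> {}" "T \<noteq> {}" "\<And>x s. x \<in> S \<Longrightarrow> s \<in> T \<Longrightarrow> \<bar>v x s\<bar> \<le> c"
  shows "sup_norm S T v \<le> c"
proof -
  have "(case z of (x, s) \<Rightarrow> \<bar>v x s\<bar>) \<le> c" if "z \<in> S \<times> T" for z
    using that assms(3) by (cases z) simp
  then show ?thesis unfolding sup_norm_def using assms(1,2) by (intro cSUP_least) simp_all
qed

lemma sup_norm_nonneg:
  assumes "compact S" "compact T" "v \<in> C_space S T" "S \<noteq> {}" "T \<noteq> {}"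
  shows "0 \<le> sup_norm S T v"
proof -
  obtain x s where "x \<in> S" "s \<in> T" using assms by blast
  from sup_norm_upper[OF assms(1-3) this] show ?thesis by simp
qed

lemma sup_norm_cmult:
  assumes "compact S" "compact T" "v \<in> C_space S T" "S \<noteq> {}" "T \<noteq> {}" "c > 0"
  shows "sup_norm S T (\<lambda>x s. c * v x s) = c * sup_norm S T v"
proof -
  have "sup_norm S T (\<lambda>x s. c * v x s) = (SUP z\<in>S \<times> T. c * (case z of (x, s) \<Rightarrow> \<bar>v x s\<bar>))"
    unfolding sup_norm_def using assms(6) by (intro SUP_cong) (auto simp: abs_mult)
  also have "\<dots> = c * sup_norm S T v"
    unfolding sup_norm_def using assms by (intro cSUP_mult_left sup_norm_bdd) auto
  finally show ?thesis .
qed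

lemma C_space_iff: "v \<in> C_space S T \<longleftrightarrow> continuous_on (S \<times> T) (\<lambda>z. v (fst z) (snd z))"
  by (simp add: C_space_def case_prod_unfold)

lemma C_space_mult:
  "v \<in> C_space S T \<Longrightarrow> w \<in> C_space S T \<Longrightarrow> (\<lambda>x s. v x s * w x s) \<in> C_space S T"
  unfolding C_space_iff by (rule continuous_on_mult)

lemma C_space_cmult: "v \<in> C_space S T \<Longrightarrow> (\<lambda>x s. c * v x s) \<in> C_space S T"
  unfolding C_space_iff by (rule continuous_on_mult_left)

lemma C_space_sum:
  "(\<And>i. i \<in> I \<Longrightarrow> v i \<in> C_space S T) \<Longrightarrow> (\<lambda>x s. \<Sum>i\<in>I. v i x s) \<in> C_space S T"
  unfolding C_space_iff by (rule continuous_on_sum)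

lemma C_space_mono: "v \<in> C_space S T \<Longrightarrow> S' \<subseteq> S \<Longrightarrow> v \<in> C_space S' T"
  unfolding C_space_iff by (erule continuous_on_subset) auto

locale bounded_domain =
  fixes \<Omega> :: "'a::euclidean_space set"
  assumes open_domain: "open \<Omega>" and bounded_domain: "bounded \<Omega>" and nonempty: "\<Omega> \<noteq> {}"
begin

lemma domain_lmeasurable: "\<Omega> \<in> lmeasurable"
  using bounded_domain open_domain lmeasurable_open by blast

lemma domain_sets [measurable]: "\<Omega> \<in> sets lebesgue"
  using domain_lmeasurable by blast

lemma emeasure_domain: "emeasure (lebesgue_on \<Omega>) (space (lebesgue_on \<Omega>)) \<noteq> 0"
proof -
  have "\<not> negligible \<Omega>" using open_domain nonempty open_not_negligible by blast
  then have "\<Omega> \<notin> null_sets lebesgue" by (simp add: negligible_iff_null_sets)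
  then have "emeasure lebesgue \<Omega> \<noteq> 0" using domain_sets by blast
  then show ?thesis using emeasure_restrict_space[of \<Omega> lebesgue \<Omega>] domain_sets by simp
qed

lemma compact_closure_domain: "compact (closure \<Omega>)"
  using bounded_domain by (simp add: compact_closure)

lemma compact_frontier_domain: "compact (frontier \<Omega>)"
  using bounded_domain by (simp add: compact_frontier_bounded)

lemma frontier_nonempty: "frontier \<Omega> \<noteq> {}"
  using nonempty bounded_domain not_bounded_UNIV by (auto simp: frontier_eq_empty)

text \<open>Over a null set the essential supremum would be \<open>-\<infinity>\<close>; an open nonempty set has positive
  measure.\<close>

lemma esssup_abs_nonneg:
  assumes "f \<in> borel_measurable (lebesgue_on \<Omega>)"
  shows "0 \<le> esssup (lebesgue_on \<Omega>) (\<lambda>y. ereal \<bar>f y\<bar>)"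
proof -
  have "0 = esssup (lebesgue_on \<Omega>) (\<lambda>y. 0::ereal)" using emeasure_domain by (simp add: esssup_const)
  also have "\<dots> \<le> esssup (lebesgue_on \<Omega>) (\<lambda>y. ereal \<bar>f y\<bar>)"
    by (rule esssup_mono) auto
  finally show ?thesis .
qed

lemma ereal_Linf_norm:
  assumes "f \<in> Linf \<Omega>"
  shows "ereal (Linf_norm \<Omega> f) = esssup (lebesgue_on \<Omega>) (\<lambda>y. ereal \<bar>f y\<bar>)"
proof -
  have "0 \<le> esssup (lebesgue_on \<Omega>) (\<lambda>y. ereal \<bar>f y\<bar>)"
    "esssup (lebesgue_on \<Omega>) (\<lambda>y. ereal \<bar>f y\<bar>) < \<infinity>"
    using assms esssup_abs_nonneg by (auto simp: Linf_def)
  then show ?thesis unfolding Linf_norm_def by (intro ereal_real') auto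
qed

lemma Linf_measurable: "f \<in> Linf \<Omega> \<Longrightarrow> f \<in> borel_measurable (lebesgue_on \<Omega>)"
  by (simp add: Linf_def)

lemma Linf_AE:
  assumes "f \<in> Linf \<Omega>"
  shows "AE y in lebesgue_on \<Omega>. \<bar>f y\<bar> \<le> Linf_norm \<Omega> f"
  using esssup_AE[of "\<lambda>y. ereal \<bar>f y\<bar>" "lebesgue_on \<Omega>"]
  unfolding ereal_Linf_norm[OF assms, symmetric] by simp

lemma Linf_norm_nonneg: "f \<in> Linf \<Omega> \<Longrightarrow> 0 \<le> Linf_norm \<Omega> f"
  using esssup_abs_nonneg[OF Linf_measurable, of f] ereal_Linf_norm[of f] by (metis ereal_less_eq(5))

lemma
  assumes f: "f \<in> borel_measurable (lebesgue_on \<Omega>)"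
    and AE: "AE y in lebesgue_on \<Omega>. \<bar>f y\<bar> \<le> c"
  shows LinfI: "f \<in> Linf \<Omega>" and Linf_norm_least: "Linf_norm \<Omega> f \<le> c"
proof -
  have le: "esssup (lebesgue_on \<Omega>) (\<lambda>y. ereal \<bar>f y\<bar>) \<le> ereal c"
    using assms by (intro esssup_I) auto
  then show "f \<in> Linf \<Omega>" using f by (auto simp: Linf_def)
  from ereal_Linf_norm[OF this] le show "Linf_norm \<Omega> f \<le> c" by (metis ereal_less_eq(3))
qed

lemma Linf_norm_AE_mono:
  assumes "f \<in> Linf \<Omega>" "g \<in> Linf \<Omega>" "AE y in lebesgue_on \<Omega>. \<bar>f y\<bar> \<le> \<bar>g y\<bar>"
  shows "Linf_norm \<Omega> f \<le> Linf_norm \<Omega> g"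
proof (rule Linf_norm_least[OF Linf_measurable[OF assms(1)]])
  show "AE y in lebesgue_on \<Omega>. \<bar>f y\<bar> \<le> Linf_norm \<Omega> g"
    using assms(3) Linf_AE[OF assms(2)] by eventually_elim simp
qed

lemma
  assumes "f \<in> Linf \<Omega>"
  shows Linf_cmult: "(\<lambda>y. c * f y) \<in> Linf \<Omega>"
    and Linf_norm_cmult_le: "Linf_norm \<Omega> (\<lambda>y. c * f y) \<le> \<bar>c\<bar> * Linf_norm \<Omega> f"
proof -
  have m: "(\<lambda>y. c * f y) \<in> borel_measurable (lebesgue_on \<Omega>)"
    using Linf_measurable[OF assms] by measurable
  have AE: "AE y in lebesgue_on \<Omega>. \<bar>c * f y\<bar> \<le> \<bar>c\<bar> * Linf_norm \<Omega> f"
    using Linf_AE[OF assms] by eventually_elim (auto simp: abs_mult mult_left_mono)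
  show "(\<lambda>y. c * f y) \<in> Linf \<Omega>" by (rule LinfI[OF m AE])
  show "Linf_norm \<Omega> (\<lambda>y. c * f y) \<le> \<bar>c\<bar> * Linf_norm \<Omega> f" by (rule Linf_norm_least[OF m AE])
qed

lemma Linf_norm_cmult:
  assumes "f \<in> Linf \<Omega>" "c > 0"
  shows "Linf_norm \<Omega> (\<lambda>y. c * f y) = c * Linf_norm \<Omega> f"
proof (rule antisym)
  show "Linf_norm \<Omega> (\<lambda>y. c * f y) \<le> c * Linf_norm \<Omega> f"
    using Linf_norm_cmult_le[OF assms(1), of c] assms(2) by simp
  have "(\<lambda>y. (1 / c) * (c * f y)) = f" using assms(2) by auto
  then have "Linf_norm \<Omega> f \<le> (1 / c) * Linf_norm \<Omega> (\<lambda>y. c * f y)"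
    using Linf_norm_cmult_le[OF Linf_cmult[OF assms(1), of c], of "1 / c"] assms(2) by simp
  then show "c * Linf_norm \<Omega> f \<le> Linf_norm \<Omega> (\<lambda>y. c * f y)"
    using assms(2) by (simp add: pos_le_divide_eq mult.commute)
qed

lemma
  assumes "\<And>i. i \<in> I \<Longrightarrow> f i \<in> Linf \<Omega>" "finite I"
  shows Linf_sum: "(\<lambda>y. \<Sum>i\<in>I. f i y) \<in> Linf \<Omega>"
    and Linf_norm_sum_le: "Linf_norm \<Omega> (\<lambda>y. \<Sum>i\<in>I. f i y) \<le> (\<Sum>i\<in>I. Linf_norm \<Omega> (f i))"
proof -
  have m: "(\<lambda>y. \<Sum>i\<in>I. f i y) \<in> borel_measurable (lebesgue_on \<Omega>)"
    using assms Linf_measurable by (intro borel_measurable_sum) auto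
  have "AE y in lebesgue_on \<Omega>. \<forall>i\<in>I. \<bar>f i y\<bar> \<le> Linf_norm \<Omega> (f i)"
    using assms Linf_AE by (intro AE_finite_allI) auto
  then have AE: "AE y in lebesgue_on \<Omega>. \<bar>\<Sum>i\<in>I. f i y\<bar> \<le> (\<Sum>i\<in>I. Linf_norm \<Omega> (f i))"
    by eventually_elim (rule order_trans[OF sum_abs sum_mono], auto)
  show "(\<lambda>y. \<Sum>i\<in>I. f i y) \<in> Linf \<Omega>" by (rule LinfI[OF m AE])
  show "Linf_norm \<Omega> (\<lambda>y. \<Sum>i\<in>I. f i y) \<le> (\<Sum>i\<in>I. Linf_norm \<Omega> (f i))"
    by (rule Linf_norm_least[OF m AE])
qed

text \<open>The Weierstrass test: off a single null set all terms are dominated by their norms, so the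
  series converges pointwise there and the tails of the numerical series bound the error.\<close>

lemma series_converges_LinfI:
  assumes f: "\<And>m. m \<ge> 1 \<Longrightarrow> f m \<in> Linf \<Omega>"
    and bound: "\<And>N. (\<Sum>m=1..N. Linf_norm \<Omega> (f m)) \<le> c"
  shows "series_converges_Linf \<Omega> f"
proof -
  define h where "h = (\<lambda>n. f (Suc n))"
  define a where "a = (\<lambda>n. Linf_norm \<Omega> (h n))"
  have h: "h n \<in> Linf \<Omega>" for n using f by (simp add: h_def)
  have a0: "a n \<ge> 0" for n using Linf_norm_nonneg[OF h] by (simp add: a_def)
  have shift: "(\<Sum>m=1..N. F m) = (\<Sum>n<N. F (Suc n))" for F :: "nat \<Rightarrow> real" and N
    using sum.shift_bounds_Suc_ivl[of F 0 N]
    by (simp add: lessThan_atLeast0 atLeastLessThanSuc_atLeastAtMost)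
  have suma: "summable a"
    using bound a0 unfolding shift a_def h_def by (intro summableI_nonneg_bounded) auto
  have AE: "AE y in lebesgue_on \<Omega>. \<forall>n. \<bar>h n y\<bar> \<le> a n"
    using Linf_AE[OF h] by (simp add: AE_all_countable a_def)
  define \<beta> where "\<beta> = (\<lambda>y. \<Sum>n. h n y)"
  have m\<beta>: "\<beta> \<in> borel_measurable (lebesgue_on \<Omega>)"
    unfolding \<beta>_def using Linf_measurable[OF h] by (intro borel_measurable_suminf)
  have tail: "AE y in lebesgue_on \<Omega>. \<bar>(\<Sum>n<N. h n y) - \<beta> y\<bar> \<le> (\<Sum>n. a (n + N))" for N
    using AE
  proof eventually_elim
    case (elim y)
    have s: "summable (\<lambda>n. \<bar>h n y\<bar>)"
      by (rule summable_comparison_test[OF _ suma]) (use elim in auto)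
    have s1: "summable (\<lambda>n. h n y)" by (rule summable_rabs_cancel[OF s])
    have "\<bar>(\<Sum>n<N. h n y) - \<beta> y\<bar> = \<bar>\<Sum>n. h (n + N) y\<bar>"
      using suminf_split_initial_segment[OF s1, of N] by (simp add: \<beta>_def)
    also have "\<dots> \<le> (\<Sum>n. \<bar>h (n + N) y\<bar>)"
      by (intro summable_rabs summable_ignore_initial_segment[OF s])
    also have "\<dots> \<le> (\<Sum>n. a (n + N))"
      using elim
      by (intro suminf_le summable_ignore_initial_segment[OF s]
          summable_ignore_initial_segment[OF suma]) simp
    finally show ?case .
  qed
  have "AE y in lebesgue_on \<Omega>. \<bar>\<beta> y\<bar> \<le> (\<Sum>n. a n)" using tail[of 0] by simp
  then have \<beta>: "\<beta> \<in> Linf \<Omega>" by (rule LinfI[OF m\<beta>])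
  have md: "(\<lambda>y. (\<Sum>n<N. h n y) - \<beta> y) \<in> borel_measurable (lebesgue_on \<Omega>)" for N
    using Linf_measurable[OF h] m\<beta> by measurable
  have "(\<lambda>N. Linf_norm \<Omega> (\<lambda>y. (\<Sum>n<N. h n y) - \<beta> y)) \<longlonglongrightarrow> 0"
  proof (rule tendsto_sandwich[OF _ _ tendsto_const])
    show "\<forall>\<^sub>F N in sequentially. 0 \<le> Linf_norm \<Omega> (\<lambda>y. (\<Sum>n<N. h n y) - \<beta> y)"
      using Linf_norm_nonneg[OF LinfI[OF md tail]] by auto
    show "\<forall>\<^sub>F N in sequentially. Linf_norm \<Omega> (\<lambda>y. (\<Sum>n<N. h n y) - \<beta> y) \<le> (\<Sum>n. a (n + N))"
      using Linf_norm_least[OF md tail] by auto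
    show "(\<lambda>N. \<Sum>n. a (n + N)) \<longlonglongrightarrow> 0" by (rule suminf_exist_split2[OF suma])
  qed
  then show ?thesis using f \<beta> unfolding series_converges_Linf_def shift h_def by blast
qed

lemma C_space_frontier_0: "(\<lambda>x s. 0) \<in> C_space (frontier \<Omega>) (frontier \<Omega>)"
  by (simp add: C_space_def case_prod_unfold)

lemma sup_norm_frontier_0: "sup_norm (frontier \<Omega>) (frontier \<Omega>) (\<lambda>x s. 0) = 0"
  using frontier_nonempty unfolding sup_norm_def case_prod_unfold by simp

lemma op_norm_bdd:
  assumes "bounded_linear_C_Linf \<Omega> A"
  shows "bdd_above ((\<lambda>\<phi>. Linf_norm \<Omega> (A \<phi>)) ` {\<phi> \<in> C_space (frontier \<Omega>) (frontier \<Omega>).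
                sup_norm (frontier \<Omega>) (frontier \<Omega>) \<phi> \<le> 1})"
proof -
  obtain B where B: "\<And>\<phi>. \<phi> \<in> C_space (frontier \<Omega>) (frontier \<Omega>) \<Longrightarrow>
      Linf_norm \<Omega> (A \<phi>) \<le> B * sup_norm (frontier \<Omega>) (frontier \<Omega>) \<phi>"
    using assms unfolding bounded_linear_C_Linf_def by blast
  have "Linf_norm \<Omega> (A \<phi>) \<le> \<bar>B\<bar>" if \<phi>: "\<phi> \<in> C_space (frontier \<Omega>) (frontier \<Omega>)"
    and le: "sup_norm (frontier \<Omega>) (frontier \<Omega>) \<phi> \<le> 1" for \<phi>
  proof -
    have "0 \<le> sup_norm (frontier \<Omega>) (frontier \<Omega>) \<phi>"
      using \<phi> compact_frontier_domain frontier_nonempty by (intro sup_norm_nonneg)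
    then have "B * sup_norm (frontier \<Omega>) (frontier \<Omega>) \<phi> \<le> \<bar>B\<bar> * 1"
      using le by (intro mult_mono) auto
    then show ?thesis using B[OF \<phi>] by simp
  qed
  then show ?thesis by (intro bdd_aboveI[of _ "\<bar>B\<bar>"]) auto
qed

lemma op_norm_nonneg:
  assumes A: "bounded_linear_C_Linf \<Omega> A"
  shows "0 \<le> op_norm \<Omega> A"
proof -
  have "0 \<le> Linf_norm \<Omega> (A (\<lambda>x s. 0))"
    using A C_space_frontier_0 by (intro Linf_norm_nonneg) (auto simp: bounded_linear_C_Linf_def)
  also have "\<dots> \<le> op_norm \<Omega> A"
    unfolding op_norm_def
    using C_space_frontier_0 sup_norm_frontier_0 by (intro cSUP_upper op_norm_bdd[OF A]) auto
  finally show ?thesis .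
qed

text \<open>Linearity holds almost everywhere only, which suffices to rescale the argument to the unit
  ball.  Data with zero norm cannot be rescaled and are covered by the boundedness of the operator.\<close>

lemma op_norm_bound:
  assumes A: "bounded_linear_C_Linf \<Omega> A" and \<phi>: "\<phi> \<in> C_space (frontier \<Omega>) (frontier \<Omega>)"
  shows "Linf_norm \<Omega> (A \<phi>) \<le> op_norm \<Omega> A * sup_norm (frontier \<Omega>) (frontier \<Omega>) \<phi>"
proof -
  let ?n = "sup_norm (frontier \<Omega>) (frontier \<Omega>)"
  have n0: "?n \<phi> \<ge> 0"
    using \<phi> compact_frontier_domain frontier_nonempty by (intro sup_norm_nonneg)
  show ?thesis
  proof (cases "?n \<phi> = 0")
    case True
    obtain B where "Linf_norm \<Omega> (A \<phi>) \<le> B * ?n \<phi>"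
      using A \<phi> by (auto simp: bounded_linear_C_Linf_def)
    then show ?thesis using True by simp
  next
    case False
    then have pos: "?n \<phi> > 0" using n0 by simp
    define c where "c = 1 / ?n \<phi>"
    have c: "c > 0" using pos by (simp add: c_def)
    have c\<phi>: "(\<lambda>x s. c * \<phi> x s) \<in> C_space (frontier \<Omega>) (frontier \<Omega>)" by (rule C_space_cmult[OF \<phi>])
    have "?n (\<lambda>x s. c * \<phi> x s) = 1"
      using sup_norm_cmult[OF compact_frontier_domain compact_frontier_domain \<phi>
        frontier_nonempty frontier_nonempty c] pos by (simp add: c_def)
    then have *: "Linf_norm \<Omega> (A (\<lambda>x s. c * \<phi> x s)) \<le> op_norm \<Omega> A"
      unfolding op_norm_def using c\<phi> by (intro cSUP_upper op_norm_bdd[OF A]) auto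
    have Aphi: "A \<phi> \<in> Linf \<Omega>" "A (\<lambda>x s. c * \<phi> x s) \<in> Linf \<Omega>"
      "AE y in lebesgue_on \<Omega>. A (\<lambda>x s. c * \<phi> x s) y = c * A \<phi> y"
      using A \<phi> c\<phi> by (auto simp: bounded_linear_C_Linf_def)
    have "c * Linf_norm \<Omega> (A \<phi>) = Linf_norm \<Omega> (\<lambda>y. c * A \<phi> y)"
      using Linf_norm_cmult[OF Aphi(1) c] by simp
    also have "\<dots> \<le> Linf_norm \<Omega> (A (\<lambda>x s. c * \<phi> x s))"
      using Aphi by (intro Linf_norm_AE_mono Linf_cmult) auto
    also note *
    finally show ?thesis using pos by (simp add: c_def field_simps)
  qed
qed

lemma bounded_linear_C_Linf_cmult:
  assumes A: "bounded_linear_C_Linf \<Omega> A"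
  shows "bounded_linear_C_Linf \<Omega> (\<lambda>\<phi> y. c * A \<phi> y)"
proof -
  let ?n = "sup_norm (frontier \<Omega>) (frontier \<Omega>)"
  have L: "\<And>\<phi>. \<phi> \<in> C_space (frontier \<Omega>) (frontier \<Omega>) \<Longrightarrow> A \<phi> \<in> Linf \<Omega>"
    using A by (auto simp: bounded_linear_C_Linf_def)
  have "AE y in lebesgue_on \<Omega>. c * A (\<lambda>x s. \<phi> x s + \<psi> x s) y = c * A \<phi> y + c * A \<psi> y"
    if "\<phi> \<in> C_space (frontier \<Omega>) (frontier \<Omega>)" "\<psi> \<in> C_space (frontier \<Omega>) (frontier \<Omega>)" for \<phi> \<psi>
  proof -
    have "AE y in lebesgue_on \<Omega>. A (\<lambda>x s. \<phi> x s + \<psi> x s) y = A \<phi> y + A \<psi> y"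
      using A that by (auto simp: bounded_linear_C_Linf_def)
    then show ?thesis by eventually_elim (simp add: algebra_simps)
  qed
  moreover have "AE y in lebesgue_on \<Omega>. c * A (\<lambda>x s. d * \<phi> x s) y = d * (c * A \<phi> y)"
    if "\<phi> \<in> C_space (frontier \<Omega>) (frontier \<Omega>)" for \<phi> d
  proof -
    have "AE y in lebesgue_on \<Omega>. A (\<lambda>x s. d * \<phi> x s) y = d * A \<phi> y"
      using A that by (auto simp: bounded_linear_C_Linf_def)
    then show ?thesis by eventually_elim simp
  qed
  moreover have "Linf_norm \<Omega> (\<lambda>y. c * A \<phi> y) \<le> (\<bar>c\<bar> * op_norm \<Omega> A) * ?n \<phi>"
    if "\<phi> \<in> C_space (frontier \<Omega>) (frontier \<Omega>)" for \<phi>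
    using Linf_norm_cmult_le[OF L[OF that], of c] mult_left_mono[OF op_norm_bound[OF A that], of "\<bar>c\<bar>"]
    by (simp add: algebra_simps)
  ultimately show ?thesis
    unfolding bounded_linear_C_Linf_def using L Linf_cmult by blast
qed

lemma op_norm_cmult:
  assumes A: "bounded_linear_C_Linf \<Omega> A" and c: "c > 0"
  shows "op_norm \<Omega> (\<lambda>\<phi> y. c * A \<phi> y) = c * op_norm \<Omega> A"
proof -
  have "op_norm \<Omega> (\<lambda>\<phi> y. c * A \<phi> y)
      = (SUP \<phi>\<in>{\<phi> \<in> C_space (frontier \<Omega>) (frontier \<Omega>).
                sup_norm (frontier \<Omega>) (frontier \<Omega>) \<phi> \<le> 1}. c * Linf_norm \<Omega> (A \<phi>))"
    unfolding op_norm_def using A c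
    by (intro SUP_cong Linf_norm_cmult refl) (auto simp: bounded_linear_C_Linf_def)
  also have "\<dots> = c * op_norm \<Omega> A"
    unfolding op_norm_def using c C_space_frontier_0 sup_norm_frontier_0
    by (intro cSUP_mult_left op_norm_bdd[OF A]) (auto intro!: exI[of _ "\<lambda>x s. 0"])
  finally show ?thesis .
qed

end

section \<open>Volume potentials of weakly singular kernels\<close>

text \<open>The exponent may have either sign; the factor \<open>2 ^ d\<close> is what a negative exponent costs on a
  dyadic shell.\<close>

lemma powr_dyadic_bound:
  fixes t \<rho> \<alpha> :: real and d :: nat
  assumes "\<alpha> > 0" "\<rho> / 2 \<le> t" "t \<le> \<rho>" "0 < \<rho>"
  shows "t powr (\<alpha> - real d) \<le> 2 ^ d * \<rho> powr (\<alpha> - real d)"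
proof (cases "\<alpha> \<ge> real d")
  case True
  have "t powr (\<alpha> - real d) \<le> \<rho> powr (\<alpha> - real d)"
    using assms True by (intro powr_mono2) auto
  also have "\<dots> \<le> 2 ^ d * \<rho> powr (\<alpha> - real d)"
    using mult_right_mono[of 1 "2 ^ d" "\<rho> powr (\<alpha> - real d)"] by simp
  finally show ?thesis .
next
  case False
  have "t powr (\<alpha> - real d) \<le> (\<rho> / 2) powr (\<alpha> - real d)"
    using assms False by (intro powr_mono2') auto
  also have "\<dots> = 2 powr (real d - \<alpha>) * \<rho> powr (\<alpha> - real d)"
    using assms by (simp add: powr_divide powr_diff field_simps)
  also have "\<dots> \<le> 2 powr real d * \<rho> powr (\<alpha> - real d)"
    using assms by (intro mult_right_mono powr_mono) auto
  finally show ?thesis by (simp add: powr_realpow)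
qed

lemma dyadic_exists:
  fixes t \<delta> :: real
  assumes "0 < t" "t < \<delta>"
  shows "\<exists>j. \<delta> / 2 ^ j / 2 \<le> t \<and> t < \<delta> / 2 ^ j"
proof -
  obtain n where n: "\<delta> / t < 2 ^ n"
    using real_arch_pow[of 2 "\<delta> / t"] by auto
  define m where "m = (LEAST n. \<delta> / t \<le> 2 ^ n)"
  have m: "\<delta> / t \<le> 2 ^ m" unfolding m_def by (rule LeastI[of _ n]) (use n in simp)
  have "m \<noteq> 0" using m assms by (auto intro!: Nat.gr0I simp: field_simps)
  then obtain j where j: "m = Suc j" by (cases m) auto
  then have "\<not> \<delta> / t \<le> 2 ^ j" unfolding m_def using not_less_Least by (metis lessI)
  then show ?thesis using m assms unfolding j by (intro exI[of _ j]) (simp add: field_simps)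
qed

text \<open>Decompose the ball into dyadic shells.  On the shell of radius \<open>\<rho> = \<delta> / 2 ^ j\<close> the integrand is
  at most a multiple of \<open>\<rho>\<close> to the power \<open>\<alpha> - d\<close>, and the ball that contains the shell has volume
  proportional to \<open>\<rho> ^ d\<close>.  The contributions form a geometric series with ratio \<open>2 powr (- \<alpha>)\<close>.\<close>

lemma nn_integral_dist_powr:
  fixes x :: "'a::euclidean_space"
  assumes "\<alpha> > 0"
  obtains c where "c \<ge> 0" and
    "\<And>(x::'a) \<delta>. \<delta> > 0 \<Longrightarrow> (\<integral>\<^sup>+y. ennreal (dist x y powr (\<alpha> - real DIM('a))) * indicator (ball x \<delta>) y \<partial>lborel)
        \<le> ennreal (c * \<delta> powr \<alpha>)"
proof -
  let ?d = "DIM('a)" and ?V = "unit_ball_vol (real DIM('a))"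
  define q where "q = 2 powr (- \<alpha>)"
  have q: "0 < q" "q < 1" using assms by (auto simp: q_def powr_less_one)
  define c where "c = 2 ^ ?d * ?V * (1 / (1 - q))"
  have "(\<integral>\<^sup>+y. ennreal (dist x y powr (\<alpha> - real ?d)) * indicator (ball x \<delta>) y \<partial>lborel)
        \<le> ennreal (c * \<delta> powr \<alpha>)" if \<delta>: "\<delta> > 0" for x :: 'a and \<delta>
  proof -
    define \<rho> where "\<rho> = (\<lambda>j::nat. \<delta> / 2 ^ j)"
    have \<rho>: "\<rho> j > 0" for j using \<delta> by (simp add: \<rho>_def)
    define b where "b = (\<lambda>j. 2 ^ ?d * \<rho> j powr (\<alpha> - real ?d))"
    have pw: "ennreal (dist x y powr (\<alpha> - real ?d)) * indicator (ball x \<delta>) y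
        \<le> (\<Sum>j. ennreal (b j) * indicator (ball x (\<rho> j)) y)" for y
    proof (cases "y \<noteq> x \<and> y \<in> ball x \<delta>")
      case True
      then obtain j where j: "\<rho> j / 2 \<le> dist x y" "dist x y < \<rho> j"
        using dyadic_exists[of "dist x y" \<delta>] by (auto simp: \<rho>_def)
      have "ennreal (dist x y powr (\<alpha> - real ?d)) \<le> ennreal (b j) * indicator (ball x (\<rho> j)) y"
        using powr_dyadic_bound[OF assms j(1) less_imp_le[OF j(2)] \<rho>] j(2)
        by (simp add: b_def ennreal_leI)
      also have "\<dots> \<le> (\<Sum>j. ennreal (b j) * indicator (ball x (\<rho> j)) y)"
      proof -
        have "sum f {j} \<le> suminf f" for f :: "nat \<Rightarrow> ennreal"
          by (intro sum_le_suminf summableI) auto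
        then have "f j \<le> suminf f" for f :: "nat \<Rightarrow> ennreal" by simp
        then show ?thesis .
      qed
      finally show ?thesis using True by simp
    qed auto
    have bV: "b j * (?V * \<rho> j ^ ?d) = 2 ^ ?d * ?V * \<delta> powr \<alpha> * q ^ j" for j
    proof -
      have "b j * (?V * \<rho> j ^ ?d) = 2 ^ ?d * ?V * (\<rho> j powr (\<alpha> - real ?d) * \<rho> j powr real ?d)"
        using \<rho>[of j] by (simp add: b_def powr_realpow)
      also have "\<rho> j powr (\<alpha> - real ?d) * \<rho> j powr real ?d = \<rho> j powr \<alpha>"
        by (simp flip: powr_add)
      also have "\<rho> j powr \<alpha> = \<delta> powr \<alpha> * q ^ j"
      proof -
        have "(2 ^ j) powr \<alpha> = (2 powr \<alpha>) ^ j"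
          by (simp add: powr_powr mult.commute flip: powr_realpow)
        then show ?thesis
          unfolding \<rho>_def q_def using \<delta> by (simp add: powr_divide powr_minus power_inverse field_simps)
      qed
      finally show ?thesis by simp
    qed
    have "(\<integral>\<^sup>+y. ennreal (dist x y powr (\<alpha> - real ?d)) * indicator (ball x \<delta>) y \<partial>lborel)
        \<le> (\<integral>\<^sup>+y. (\<Sum>j. ennreal (b j) * indicator (ball x (\<rho> j)) y) \<partial>lborel)"
      by (intro nn_integral_mono pw)
    also have "\<dots> = (\<Sum>j. \<integral>\<^sup>+y. ennreal (b j) * indicator (ball x (\<rho> j)) y \<partial>lborel)"
      proof (intro nn_integral_suminf)
      fix j
      have [measurable]: "ball x (\<rho> j) \<in> sets borel" by simp
      show "(\<lambda>y. ennreal (b j) * indicator (ball x (\<rho> j)) y) \<in> borel_measurable lborel"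
        by measurable
    qed
    also have "\<dots> = (\<Sum>j. ennreal (2 ^ ?d * ?V * \<delta> powr \<alpha> * q ^ j))"
    proof (rule suminf_cong)
      fix j
      have "(\<integral>\<^sup>+y. ennreal (b j) * indicator (ball x (\<rho> j)) y \<partial>lborel)
          = ennreal (b j) * ennreal (?V * \<rho> j ^ ?d)"
        using \<rho>[of j] by (simp add: nn_integral_cmult_indicator emeasure_ball less_imp_le)
      also have "\<dots> = ennreal (b j * (?V * \<rho> j ^ ?d))"
        using \<rho>[of j] by (intro ennreal_mult[symmetric]) (auto simp: b_def)
      finally show "(\<integral>\<^sup>+y. ennreal (b j) * indicator (ball x (\<rho> j)) y \<partial>lborel)
          = ennreal (2 ^ ?d * ?V * \<delta> powr \<alpha> * q ^ j)" by (simp only: bV)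
    qed
    also have "\<dots> = ennreal (c * \<delta> powr \<alpha>)"
    proof -
      have "(\<lambda>j. 2 ^ ?d * ?V * \<delta> powr \<alpha> * q ^ j) sums (2 ^ ?d * ?V * \<delta> powr \<alpha> * (1 / (1 - q)))"
        using q by (intro sums_mult geometric_sums) simp
      then have "(\<lambda>j. 2 ^ ?d * ?V * \<delta> powr \<alpha> * q ^ j) sums (c * \<delta> powr \<alpha>)"
        by (simp add: c_def mult_ac)
      then have "(\<lambda>j. ennreal (2 ^ ?d * ?V * \<delta> powr \<alpha> * q ^ j)) sums ennreal (c * \<delta> powr \<alpha>)"
        using q by (subst sums_ennreal) (auto simp: c_def)
      then show ?thesis by (rule sums_unique[symmetric])
    qed
    finally show ?thesis .
  qed
  moreover have "c \<ge> 0" using q by (simp add: c_def)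
  ultimately show ?thesis using that by blast
qed

locale weakly_singular_kernel = bounded_domain \<Omega> for \<Omega> :: "'a::euclidean_space set" +
  fixes G :: "'a \<Rightarrow> 'a \<Rightarrow> real"
  assumes weakly_singular: "weakly_singular \<Omega> G"
begin

text \<open>Nothing is known about the kernel on the diagonal, which is therefore discarded as a null set.\<close>

lemma AE_neq: "AE y in lebesgue_on \<Omega>. y \<noteq> x"
proof -
  have "AE y in lebesgue. y \<noteq> x" by (rule AE_completion) (rule AE_lborel_singleton)
  then show ?thesis by (subst AE_restrict_space_iff) (auto simp: domain_sets)
qed

lemma borel_measurable_on_domain:
  fixes f :: "'a \<Rightarrow> real"
  assumes "f \<in> borel_measurable borel"
  shows "f \<in> borel_measurable (lebesgue_on \<Omega>)"
  using assms by (intro measurable_restrict_space1 measurable_completion) simp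

lemma continuous_kernel:
  assumes "x \<in> closure \<Omega>"
  shows "continuous_on (\<Omega> - {x}) (G x)"
proof -
  have "continuous_on {(x, y). x \<in> closure \<Omega> \<and> y \<in> \<Omega> \<and> x \<noteq> y} (\<lambda>(x, y). G x y)"
    using weakly_singular by (simp add: weakly_singular_def)
  then have "continuous_on (\<Omega> - {x}) (\<lambda>y. (\<lambda>(x, y). G x y) (x, y))"
    by (rule continuous_on_compose2) (use assms in \<open>auto intro!: continuous_intros\<close>)
  then show ?thesis by simp
qed

lemma kernel_measurable:
  assumes "x \<in> closure \<Omega>"
  shows "G x \<in> borel_measurable (lebesgue_on \<Omega>)"
proof -
  have s: "\<Omega> - {x} \<in> sets lebesgue" by (intro sets.Diff domain_sets) simp
  have "G x \<in> borel_measurable (lebesgue_on (\<Omega> - {x}))"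
    using continuous_kernel[OF assms] s by (rule continuous_imp_measurable_on_sets_lebesgue)
  then have 1: "(\<lambda>y. if y \<in> \<Omega> - {x} then G x y else 0) \<in> borel_measurable lebesgue"
    using s borel_measurable_if by blast
  have "(\<lambda>y. if y \<in> \<Omega> - {x} then G x y else 0) \<in> borel_measurable (lebesgue_on \<Omega>)"
    by (rule measurable_restrict_space1[OF 1])
  moreover have "(\<lambda>y. indicator {x} y * G x x) \<in> borel_measurable (lebesgue_on \<Omega>)"
    by (intro borel_measurable_on_domain) measurable
  ultimately have "(\<lambda>y. (if y \<in> \<Omega> - {x} then G x y else 0) + indicator {x} y * G x x)
      \<in> borel_measurable (lebesgue_on \<Omega>)"
    by (rule borel_measurable_add)
  then show ?thesis
    by (rule measurable_cong[THEN iffD1, rotated]) (auto simp: indicator_def)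
qed

lemma kernel_local_bound:
  obtains c \<alpha> where "c \<ge> 0" "\<alpha> > 0"
    "\<And>x \<delta>. x \<in> closure \<Omega> \<Longrightarrow> \<delta> > 0 \<Longrightarrow>
       (\<integral>\<^sup>+y. ennreal \<bar>G x y\<bar> * indicator (ball x \<delta>) y \<partial>lebesgue_on \<Omega>) \<le> ennreal (c * \<delta> powr \<alpha>)"
proof -
  obtain M \<alpha> where \<alpha>: "\<alpha> > 0" and M: "\<And>x y. x \<in> closure \<Omega> \<Longrightarrow> y \<in> \<Omega> \<Longrightarrow> x \<noteq> y \<Longrightarrow>
      \<bar>G x y\<bar> \<le> M * dist x y powr (\<alpha> - real DIM('a))"
    using weakly_singular by (auto simp: weakly_singular_def)
  obtain c where c: "c \<ge> 0" and int: "\<And>(x::'a) \<delta>. \<delta> > 0 \<Longrightarrow>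
      (\<integral>\<^sup>+y. ennreal (dist x y powr (\<alpha> - real DIM('a))) * indicator (ball x \<delta>) y \<partial>lborel)
        \<le> ennreal (c * \<delta> powr \<alpha>)"
    using nn_integral_dist_powr[OF \<alpha>] by metis
  show ?thesis
  proof (rule that[of "\<bar>M\<bar> * c" \<alpha>])
    fix x \<delta> assume x: "x \<in> closure \<Omega>" and \<delta>: "(\<delta>::real) > 0"
    let ?f = "\<lambda>y. ennreal (dist x y powr (\<alpha> - real DIM('a))) * indicator (ball x \<delta>) y"
    have [measurable]: "ball x \<delta> \<in> sets borel" by simp
    have "(\<integral>\<^sup>+y. ennreal \<bar>G x y\<bar> * indicator (ball x \<delta>) y \<partial>lebesgue_on \<Omega>)
        \<le> (\<integral>\<^sup>+y. ennreal \<bar>M\<bar> * ?f y \<partial>lebesgue_on \<Omega>)"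
    proof (rule nn_integral_mono_AE)
      have "AE y in lebesgue_on \<Omega>. y \<in> \<Omega>" by (rule AE_I2) simp
      then show "AE y in lebesgue_on \<Omega>. ennreal \<bar>G x y\<bar> * indicator (ball x \<delta>) y \<le> ennreal \<bar>M\<bar> * ?f y"
        using AE_neq[of x]
      proof eventually_elim
        case (elim y)
        have "\<bar>G x y\<bar> \<le> M * dist x y powr (\<alpha> - real DIM('a))" using M[OF x elim(1)] elim(2) by simp
        also have "\<dots> \<le> \<bar>M\<bar> * dist x y powr (\<alpha> - real DIM('a))" by (intro mult_right_mono) auto
        finally show ?case by (auto simp: indicator_def ennreal_leI simp flip: ennreal_mult)
      qed
    qed
    also have "\<dots> = (\<integral>\<^sup>+y. ennreal \<bar>M\<bar> * ?f y * indicator \<Omega> y \<partial>lebesgue)"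
      by (rule nn_integral_restrict_space) (simp add: domain_sets)
    also have "\<dots> \<le> (\<integral>\<^sup>+y. ennreal \<bar>M\<bar> * ?f y \<partial>lebesgue)"
      by (intro nn_integral_mono) (auto simp: indicator_def)
    also have "\<dots> = (\<integral>\<^sup>+y. ennreal \<bar>M\<bar> * ?f y \<partial>lborel)"
      by (intro nn_integral_completion) measurable
    also have "\<dots> = ennreal \<bar>M\<bar> * (\<integral>\<^sup>+y. ?f y \<partial>lborel)"
      by (intro nn_integral_cmult) measurable
    also have "\<dots> \<le> ennreal \<bar>M\<bar> * ennreal (c * \<delta> powr \<alpha>)"
      using int[OF \<delta>, of x] by (intro mult_left_mono) auto
    also have "\<dots> = ennreal (\<bar>M\<bar> * c * \<delta> powr \<alpha>)"
      using c by (simp add: ennreal_mult mult.assoc)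
    finally show "(\<integral>\<^sup>+y. ennreal \<bar>G x y\<bar> * indicator (ball x \<delta>) y \<partial>lebesgue_on \<Omega>)
        \<le> ennreal (\<bar>M\<bar> * c * \<delta> powr \<alpha>)" .
  qed (use c \<alpha> in auto)
qed

lemma kernel_L1_bound:
  obtains B where "\<And>x. x \<in> closure \<Omega> \<Longrightarrow> integrable (lebesgue_on \<Omega>) (G x)"
    "\<And>x. x \<in> closure \<Omega> \<Longrightarrow> (LINT y|lebesgue_on \<Omega>. \<bar>G x y\<bar>) \<le> B"
proof -
  obtain c \<alpha> where c: "c \<ge> 0" "\<alpha> > 0" and
    b: "\<And>x \<delta>. x \<in> closure \<Omega> \<Longrightarrow> \<delta> > 0 \<Longrightarrow>
       (\<integral>\<^sup>+y. ennreal \<bar>G x y\<bar> * indicator (ball x \<delta>) y \<partial>lebesgue_on \<Omega>) \<le> ennreal (c * \<delta> powr \<alpha>)"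
    using kernel_local_bound by blast
  obtain D where D: "D > 0" "\<And>x y. x \<in> closure \<Omega> \<Longrightarrow> y \<in> closure \<Omega> \<Longrightarrow> dist x y < D"
  proof -
    obtain e where "\<And>x y. x \<in> closure \<Omega> \<Longrightarrow> y \<in> closure \<Omega> \<Longrightarrow> dist x y \<le> e"
      using compact_closure_domain compact_imp_bounded bounded_two_points by metis
    then show ?thesis by (intro that[of "\<bar>e\<bar> + 1"]) force+
  qed
  have le: "(\<integral>\<^sup>+y. ennreal \<bar>G x y\<bar> \<partial>lebesgue_on \<Omega>) \<le> ennreal (c * D powr \<alpha>)"
    if x: "x \<in> closure \<Omega>" for x
  proof -
    have "y \<in> ball x D" if "y \<in> \<Omega>" for y using D(2)[OF x] that closure_subset[of \<Omega>] by auto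
    then have "(\<integral>\<^sup>+y. ennreal \<bar>G x y\<bar> \<partial>lebesgue_on \<Omega>)
      = (\<integral>\<^sup>+y. ennreal \<bar>G x y\<bar> * indicator (ball x D) y \<partial>lebesgue_on \<Omega>)"
      by (intro nn_integral_cong) (auto simp: indicator_def)
    with b[OF x D(1)] show ?thesis by simp
  qed
  have int: "integrable (lebesgue_on \<Omega>) (G x)" if x: "x \<in> closure \<Omega>" for x
    using kernel_measurable[OF x] le[OF x]
    by (intro integrableI_bounded) (auto intro: le_less_trans)
  show ?thesis
  proof (rule that[OF int])
    fix x assume x: "x \<in> closure \<Omega>"
    have "ennreal (LINT y|lebesgue_on \<Omega>. \<bar>G x y\<bar>) = (\<integral>\<^sup>+y. ennreal \<bar>G x y\<bar> \<partial>lebesgue_on \<Omega>)"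
      using int[OF x] by (intro nn_integral_eq_integral[symmetric]) auto
    with le[OF x] have "ennreal (LINT y|lebesgue_on \<Omega>. \<bar>G x y\<bar>) \<le> ennreal (c * D powr \<alpha>)" by simp
    then show "(LINT y|lebesgue_on \<Omega>. \<bar>G x y\<bar>) \<le> c * D powr \<alpha>"
      using c by (subst (asm) ennreal_le_iff) auto
  qed
qed

lemma kernel_integrable: "x \<in> closure \<Omega> \<Longrightarrow> integrable (lebesgue_on \<Omega>) (G x)"
  using kernel_L1_bound by metis


lemma
  assumes x: "x \<in> closure \<Omega>" and h: "h \<in> borel_measurable (lebesgue_on \<Omega>)"
    and AE: "AE y in lebesgue_on \<Omega>. \<bar>h y\<bar> \<le> H"
  shows kernel_mult_integrable: "integrable (lebesgue_on \<Omega>) (\<lambda>y. G x y * h y)"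
    and kernel_mult_bound: "\<bar>LINT y|lebesgue_on \<Omega>. G x y * h y\<bar> \<le> H * (LINT y|lebesgue_on \<Omega>. \<bar>G x y\<bar>)"
proof -
  have le: "AE y in lebesgue_on \<Omega>. \<bar>G x y * h y\<bar> \<le> H * \<bar>G x y\<bar>"
    using AE by eventually_elim (simp add: abs_mult mult.commute mult_right_mono)
  have i: "integrable (lebesgue_on \<Omega>) (\<lambda>y. H * \<bar>G x y\<bar>)"
    using kernel_integrable[OF x] by auto
  have m: "(\<lambda>y. G x y * h y) \<in> borel_measurable (lebesgue_on \<Omega>)"
    using kernel_measurable[OF x] h by measurable
  show int: "integrable (lebesgue_on \<Omega>) (\<lambda>y. G x y * h y)"
    by (rule Bochner_Integration.integrable_bound[OF i m]) (use le in eventually_elim, simp)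
  have "\<bar>LINT y|lebesgue_on \<Omega>. G x y * h y\<bar> \<le> (LINT y|lebesgue_on \<Omega>. \<bar>G x y * h y\<bar>)"
    by (rule integral_abs_bound)
  also have "\<dots> \<le> (LINT y|lebesgue_on \<Omega>. H * \<bar>G x y\<bar>)"
    using int i le by (intro integral_mono_AE) auto
  finally show "\<bar>LINT y|lebesgue_on \<Omega>. G x y * h y\<bar> \<le> H * (LINT y|lebesgue_on \<Omega>. \<bar>G x y\<bar>)"
    by simp
qed

lemma section_measurable:
  assumes "v \<in> C_space (closure \<Omega>) T" "s \<in> T"
  shows "(\<lambda>y. v y s) \<in> borel_measurable (lebesgue_on \<Omega>)"
proof -
  have "continuous_on \<Omega> (\<lambda>y. v (fst (y, s)) (snd (y, s)))"
    by (rule continuous_on_compose2[OF assms(1)[unfolded C_space_iff]])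
      (use assms(2) closure_subset[of \<Omega>] in \<open>auto intro!: continuous_intros\<close>)
  then show ?thesis
    using domain_sets by (simp add: continuous_imp_measurable_on_sets_lebesgue)
qed

lemma coefficient_product:
  assumes \<beta>: "\<beta> \<in> Linf \<Omega>" and v: "v \<in> C_space (closure \<Omega>) T" and T: "compact T" and s: "s \<in> T"
  shows "(\<lambda>y. \<beta> y * v y s) \<in> borel_measurable (lebesgue_on \<Omega>)"
    and "AE y in lebesgue_on \<Omega>. \<bar>\<beta> y * v y s\<bar> \<le> Linf_norm \<Omega> \<beta> * sup_norm (closure \<Omega>) T v"
proof -
  show "(\<lambda>y. \<beta> y * v y s) \<in> borel_measurable (lebesgue_on \<Omega>)"
    using Linf_measurable[OF \<beta>] section_measurable[OF v s] by measurable
  have "AE y in lebesgue_on \<Omega>. y \<in> \<Omega>" by (rule AE_I2) simp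
  then show "AE y in lebesgue_on \<Omega>. \<bar>\<beta> y * v y s\<bar> \<le> Linf_norm \<Omega> \<beta> * sup_norm (closure \<Omega>) T v"
    using Linf_AE[OF \<beta>]
  proof eventually_elim
    case (elim y)
    have "\<bar>v y s\<bar> \<le> sup_norm (closure \<Omega>) T v"
      using elim(1) closure_subset s
      by (intro sup_norm_upper[OF compact_closure_domain T v]) auto
    then show ?case using elim(2) Linf_norm_nonneg[OF \<beta>]
      by (auto simp: abs_mult intro: mult_mono)
  qed
qed

text \<open>Continuous, zero up to \<open>1 / n\<close> and one from \<open>2 / n\<close> on: multiplying the kernel by this
  function of the distance removes the singularity without creating a discontinuity.\<close>

definition cutoff :: "nat \<Rightarrow> real \<Rightarrow> real" where
  "cutoff n t = min 1 (max 0 (real n * t - 1))"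

lemma truncated_kernel_bounded:
  obtains K where "\<And>x y. x \<in> closure \<Omega> \<Longrightarrow> y \<in> \<Omega> \<Longrightarrow> \<bar>cutoff n (dist x y) * G x y\<bar> \<le> K"
proof -
  obtain M \<alpha> where M: "\<And>x y. x \<in> closure \<Omega> \<Longrightarrow> y \<in> \<Omega> \<Longrightarrow> x \<noteq> y \<Longrightarrow>
      \<bar>G x y\<bar> \<le> M * dist x y powr (\<alpha> - real DIM('a))"
    using weakly_singular by (auto simp: weakly_singular_def)
  obtain D where D: "\<And>x y. x \<in> closure \<Omega> \<Longrightarrow> y \<in> closure \<Omega> \<Longrightarrow> dist x y \<le> D"
    using compact_closure_domain compact_imp_bounded bounded_two_points by metis
  let ?p = "\<alpha> - real DIM('a)"
  show ?thesis
  proof (rule that[of "\<bar>M\<bar> * ((1 / real n) powr ?p + D powr ?p)"])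
    fix x y assume x: "x \<in> closure \<Omega>" and y: "y \<in> \<Omega>"
    show "\<bar>cutoff n (dist x y) * G x y\<bar> \<le> \<bar>M\<bar> * ((1 / real n) powr ?p + D powr ?p)"
    proof (cases "real n * dist x y \<le> 1")
      case True
      then show ?thesis by (simp add: cutoff_def)
    next
      case False
      then have n: "n > 0" and xy: "x \<noteq> y" by (auto intro: Nat.gr0I)
      have t: "1 / real n \<le> dist x y" "dist x y \<le> D"
        using False n D[OF x] y closure_subset[of \<Omega>] by (auto simp: field_simps)
      have "dist x y powr ?p \<le> (1 / real n) powr ?p + D powr ?p"
      proof (cases "?p \<ge> 0")
        case True
        then have "dist x y powr ?p \<le> D powr ?p" using t by (intro powr_mono2) auto
        then show ?thesis using powr_ge_zero[of "1 / real n" ?p] by linarith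
      next
        case False
        then have "dist x y powr ?p \<le> (1 / real n) powr ?p" using t n by (intro powr_mono2') auto
        then show ?thesis using powr_ge_zero[of D ?p] by linarith
      qed
      then have "\<bar>M\<bar> * dist x y powr ?p \<le> \<bar>M\<bar> * ((1 / real n) powr ?p + D powr ?p)"
        by (intro mult_left_mono) auto
      moreover have "M * dist x y powr ?p \<le> \<bar>M\<bar> * dist x y powr ?p"
        by (intro mult_right_mono) auto
      moreover have "\<bar>cutoff n (dist x y) * G x y\<bar> \<le> \<bar>G x y\<bar>"
        using mult_right_mono[of "\<bar>cutoff n (dist x y)\<bar>" 1 "\<bar>G x y\<bar>"]
        by (simp add: cutoff_def abs_mult)
      ultimately show ?thesis using M[OF x y xy] by linarith
    qed
  qed
qed

lemma cutoff_measurable [measurable]: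
  "(\<lambda>y. cutoff n (dist x y)) \<in> borel_measurable (lebesgue_on \<Omega>)"
  unfolding cutoff_def by (intro borel_measurable_on_domain) measurable

text \<open>The truncated kernel is bounded, and continuous in the first variable except where the two
  variables coincide, so dominated convergence applies along every sequence.\<close>

lemma truncated_potential_continuous:
  assumes \<beta>: "\<beta> \<in> Linf \<Omega>" and v: "v \<in> C_space (closure \<Omega>) T" and T: "compact T"
  shows "continuous_on (closure \<Omega> \<times> T) (\<lambda>z. LINT y|lebesgue_on \<Omega>.
           cutoff n (dist (fst z) y) * G (fst z) y * (\<beta> y * v y (snd z)))"
proof -
  obtain K where K: "\<And>x y. x \<in> closure \<Omega> \<Longrightarrow> y \<in> \<Omega> \<Longrightarrow> \<bar>cutoff n (dist x y) * G x y\<bar> \<le> K"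
    using truncated_kernel_bounded by blast
  let ?H = "Linf_norm \<Omega> \<beta> * sup_norm (closure \<Omega>) T v"
  interpret fm: finite_measure "lebesgue_on \<Omega>"
    using domain_lmeasurable by (rule finite_measure_lebesgue_on)
  have AE\<Omega>: "AE y in lebesgue_on \<Omega>. y \<in> \<Omega>" by (rule AE_I2) simp
  have m: "(\<lambda>y. cutoff n (dist (fst z) y) * G (fst z) y * (\<beta> y * v y (snd z)))
      \<in> borel_measurable (lebesgue_on \<Omega>)" if z: "z \<in> closure \<Omega> \<times> T" for z
  proof -
    have [measurable]: "(\<lambda>y. \<beta> y * v y (snd z)) \<in> borel_measurable (lebesgue_on \<Omega>)"
      by (rule coefficient_product[OF \<beta> v T]) (use z in auto)
    have [measurable]: "G (fst z) \<in> borel_measurable (lebesgue_on \<Omega>)"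
      by (rule kernel_measurable) (use z in auto)
    show ?thesis by measurable
  qed
  show ?thesis
    unfolding continuous_on_sequentially comp_def
  proof (intro allI ballI impI, elim conjE)
    fix zs z assume z: "z \<in> closure \<Omega> \<times> T" and zs: "\<forall>i. zs i \<in> closure \<Omega> \<times> T" "zs \<longlonglongrightarrow> z"
    show "(\<lambda>i. LINT y|lebesgue_on \<Omega>.
           cutoff n (dist (fst (zs i)) y) * G (fst (zs i)) y * (\<beta> y * v y (snd (zs i))))
        \<longlonglongrightarrow> (LINT y|lebesgue_on \<Omega>.
           cutoff n (dist (fst z) y) * G (fst z) y * (\<beta> y * v y (snd z)))"
    proof (rule integral_dominated_convergence[where w = "\<lambda>y. K * ?H"])
      show "integrable (lebesgue_on \<Omega>) (\<lambda>y. K * ?H)" by simp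
      show "AE y in lebesgue_on \<Omega>.
          norm (cutoff n (dist (fst (zs i)) y) * G (fst (zs i)) y * (\<beta> y * v y (snd (zs i)))) \<le> K * ?H"
        for i
      proof -
        have i: "fst (zs i) \<in> closure \<Omega>" "snd (zs i) \<in> T" using zs(1) by (auto simp: mem_Times_iff)
        show ?thesis
          using AE\<Omega> coefficient_product(2)[OF \<beta> v T i(2)]
        proof eventually_elim
          case (elim y)
          have "\<bar>cutoff n (dist (fst (zs i)) y) * G (fst (zs i)) y\<bar> \<le> K" by (rule K[OF i(1) elim(1)])
          with elim(2) show ?case unfolding real_norm_def abs_mult[of "cutoff _ _ * _"]
            by (intro mult_mono) (auto intro: order_trans[OF abs_ge_zero])
        qed
      qed
      show "AE y in lebesgue_on \<Omega>.
        (\<lambda>i. cutoff n (dist (fst (zs i)) y) * G (fst (zs i)) y * (\<beta> y * v y (snd (zs i))))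
          \<longlonglongrightarrow> cutoff n (dist (fst z) y) * G (fst z) y * (\<beta> y * v y (snd z))"
        using AE\<Omega> AE_neq[of "fst z"]
      proof eventually_elim
        case (elim y)
        have fz: "(\<lambda>i. fst (zs i)) \<longlonglongrightarrow> fst z" and sz: "(\<lambda>i. snd (zs i)) \<longlonglongrightarrow> snd z"
          using zs(2) by (auto intro: tendsto_fst tendsto_snd)
        have "(\<lambda>i. cutoff n (dist (fst (zs i)) y)) \<longlonglongrightarrow> cutoff n (dist (fst z) y)"
          unfolding cutoff_def by (intro tendsto_intros fz)
        moreover have "(\<lambda>i. G (fst (zs i)) y) \<longlonglongrightarrow> G (fst z) y"
        proof -
          let ?P = "{(x, y). x \<in> closure \<Omega> \<and> y \<in> \<Omega> \<and> x \<noteq> y}"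
          have "continuous_on ?P (\<lambda>(x, y). G x y)"
            using weakly_singular by (simp add: weakly_singular_def)
          moreover have "(\<lambda>i. (fst (zs i), y)) \<longlonglongrightarrow> (fst z, y)" by (intro tendsto_intros fz)
          moreover have "(fst z, y) \<in> ?P" using z elim by auto
          moreover have "\<forall>\<^sub>F i in sequentially. (fst (zs i), y) \<in> ?P"
          proof -
            have "\<forall>\<^sub>F i in sequentially. fst (zs i) \<noteq> y"
              using elim(2) by (intro tendsto_imp_eventually_ne[OF fz]) auto
            then show ?thesis
            proof eventually_elim
              case (elim i)
              show ?case using zs(1)[rule_format, of i] elim \<open>y \<in> \<Omega>\<close> by (auto simp: mem_Times_iff)
            qed
          qed
          ultimately have "(\<lambda>i. case (fst (zs i), y) of (x, y) \<Rightarrow> G x y)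
              \<longlonglongrightarrow> (case (fst z, y) of (x, y) \<Rightarrow> G x y)"
            by (rule continuous_on_tendsto_compose)
          then show ?thesis by simp
        qed
        moreover have "(\<lambda>i. v y (snd (zs i))) \<longlonglongrightarrow> v y (snd z)"
        proof -
          have "y \<in> closure \<Omega>" using elim closure_subset by auto
          then have "(y, snd z) \<in> closure \<Omega> \<times> T" "\<forall>\<^sub>F i in sequentially. (y, snd (zs i)) \<in> closure \<Omega> \<times> T"
            using z zs(1) by (auto simp: mem_Times_iff)
          moreover have "(\<lambda>i. (y, snd (zs i))) \<longlonglongrightarrow> (y, snd z)" by (intro tendsto_intros sz)
          ultimately show ?thesis
            using continuous_on_tendsto_compose[OF v[unfolded C_space_iff]] by fastforce
        qed
        ultimately show ?case by (auto intro!: tendsto_mult)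
      qed
    qed (use m z zs in auto)
  qed
qed

lemma truncation_error:
  obtains c \<alpha> where "\<alpha> > 0"
    "\<And>n x h H. n > 0 \<Longrightarrow> x \<in> closure \<Omega> \<Longrightarrow> h \<in> borel_measurable (lebesgue_on \<Omega>) \<Longrightarrow>
       (AE y in lebesgue_on \<Omega>. \<bar>h y\<bar> \<le> H) \<Longrightarrow> H \<ge> 0 \<Longrightarrow>
       \<bar>(LINT y|lebesgue_on \<Omega>. cutoff n (dist x y) * G x y * h y) - (LINT y|lebesgue_on \<Omega>. G x y * h y)\<bar>
         \<le> H * (c * (2 / real n) powr \<alpha>)"
proof -
  obtain c \<alpha> where c: "c \<ge> 0" "\<alpha> > 0" and
    b: "\<And>x \<delta>. x \<in> closure \<Omega> \<Longrightarrow> \<delta> > 0 \<Longrightarrow>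
       (\<integral>\<^sup>+y. ennreal \<bar>G x y\<bar> * indicator (ball x \<delta>) y \<partial>lebesgue_on \<Omega>) \<le> ennreal (c * \<delta> powr \<alpha>)"
    using kernel_local_bound by blast
  have main: "\<bar>(LINT y|lebesgue_on \<Omega>. cutoff n (dist x y) * G x y * h y) - (LINT y|lebesgue_on \<Omega>. G x y * h y)\<bar>
         \<le> H * (c * (2 / real n) powr \<alpha>)"
    if n: "n > 0" and x: "x \<in> closure \<Omega>" and h[measurable]: "h \<in> borel_measurable (lebesgue_on \<Omega>)"
      and AE: "AE y in lebesgue_on \<Omega>. \<bar>h y\<bar> \<le> H" and H: "H \<ge> 0" for n x h H
  proof -
    let ?\<delta> = "2 / real n"
    have i1: "integrable (lebesgue_on \<Omega>) (\<lambda>y. G x y * h y)" by (rule kernel_mult_integrable[OF x h AE])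
    have "AE y in lebesgue_on \<Omega>. \<bar>cutoff n (dist x y) * h y\<bar> \<le> H"
      using AE
    proof eventually_elim
      case (elim y)
      then show ?case using mult_mono[of "\<bar>cutoff n (dist x y)\<bar>" 1 "\<bar>h y\<bar>" H]
        by (simp add: cutoff_def abs_mult)
    qed
    then have "integrable (lebesgue_on \<Omega>) (\<lambda>y. G x y * (cutoff n (dist x y) * h y))"
      by (intro kernel_mult_integrable[OF x]) measurable
    then have i2: "integrable (lebesgue_on \<Omega>) (\<lambda>y. cutoff n (dist x y) * G x y * h y)"
      by (simp add: mult_ac)
    have ib: "integrable (lebesgue_on \<Omega>) (\<lambda>y. \<bar>G x y\<bar> * indicator (ball x ?\<delta>) y)"
    proof -
      have "(indicator (ball x ?\<delta>) :: 'a \<Rightarrow> real) \<in> borel_measurable (lebesgue_on \<Omega>)"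
        by (rule borel_measurable_on_domain[OF borel_measurable_indicator]) simp
      then have "integrable (lebesgue_on \<Omega>) (\<lambda>y. \<bar>G x y * indicator (ball x ?\<delta>) y\<bar>)"
        by (intro integrable_abs kernel_mult_integrable[OF x, where H = 1]) auto
      then show ?thesis by (simp add: abs_mult)
    qed
    have "\<bar>(LINT y|lebesgue_on \<Omega>. cutoff n (dist x y) * G x y * h y) - (LINT y|lebesgue_on \<Omega>. G x y * h y)\<bar>
        = \<bar>LINT y|lebesgue_on \<Omega>. cutoff n (dist x y) * G x y * h y - G x y * h y\<bar>"
      using i1 i2 by simp
    also have "\<dots> \<le> (LINT y|lebesgue_on \<Omega>. \<bar>cutoff n (dist x y) * G x y * h y - G x y * h y\<bar>)"
      by (rule integral_abs_bound)
    also have "\<dots> \<le> (LINT y|lebesgue_on \<Omega>. H * (\<bar>G x y\<bar> * indicator (ball x ?\<delta>) y))"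
    proof (rule integral_mono_AE)
      show "AE y in lebesgue_on \<Omega>. \<bar>cutoff n (dist x y) * G x y * h y - G x y * h y\<bar>
          \<le> H * (\<bar>G x y\<bar> * indicator (ball x ?\<delta>) y)"
        using AE
      proof eventually_elim
        case (elim y)
        show ?case
        proof (cases "y \<in> ball x ?\<delta>")
          case True
          have "\<bar>cutoff n (dist x y) * G x y * h y - G x y * h y\<bar>
              = \<bar>1 - cutoff n (dist x y)\<bar> * (\<bar>G x y\<bar> * \<bar>h y\<bar>)"
            by (simp flip: abs_mult) (simp add: algebra_simps abs_minus_commute)
          also have "\<dots> \<le> 1 * (\<bar>G x y\<bar> * H)"
            using elim H by (intro mult_mono mult_left_mono) (auto simp: cutoff_def)
          finally show ?thesis using True by (simp add: mult.commute)
        next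
          case False
          then have "cutoff n (dist x y) = 1" using n by (simp add: cutoff_def field_simps)
          then show ?thesis using H by simp
        qed
      qed
    qed (use i1 i2 ib in auto)
    also have "\<dots> = H * (LINT y|lebesgue_on \<Omega>. \<bar>G x y\<bar> * indicator (ball x ?\<delta>) y)" by simp
    also have "\<dots> \<le> H * (c * ?\<delta> powr \<alpha>)"
    proof (intro mult_left_mono H)
      have "ennreal (LINT y|lebesgue_on \<Omega>. \<bar>G x y\<bar> * indicator (ball x ?\<delta>) y)
          = (\<integral>\<^sup>+y. ennreal (\<bar>G x y\<bar> * indicator (ball x ?\<delta>) y) \<partial>lebesgue_on \<Omega>)"
        by (intro nn_integral_eq_integral[symmetric] ib) auto
      also have "\<dots> = (\<integral>\<^sup>+y. ennreal \<bar>G x y\<bar> * indicator (ball x ?\<delta>) y \<partial>lebesgue_on \<Omega>)"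
        by (intro nn_integral_cong) (auto simp: indicator_def)
      also have "\<dots> \<le> ennreal (c * ?\<delta> powr \<alpha>)" using n by (intro b[OF x]) auto
      finally show "(LINT y|lebesgue_on \<Omega>. \<bar>G x y\<bar> * indicator (ball x ?\<delta>) y) \<le> c * ?\<delta> powr \<alpha>"
        using c by (subst (asm) ennreal_le_iff) auto
    qed
    finally show ?thesis .
  qed
  show ?thesis by (rule that[OF c(2)]) (rule main)
qed

text \<open>The potentials of the truncated kernels converge uniformly by the local bound on the kernel.\<close>

lemma b_op_C_space:
  assumes \<beta>: "\<beta> \<in> Linf \<Omega>" and v: "v \<in> C_space (closure \<Omega>) T" and T: "compact T"
  shows "b_op \<Omega> k G v \<beta> \<in> C_space (closure \<Omega>) T"
proof (cases "T = {}")
  case False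
  obtain c \<alpha> where \<alpha>: "\<alpha> > 0" and err:
    "\<And>n x h H. n > 0 \<Longrightarrow> x \<in> closure \<Omega> \<Longrightarrow> h \<in> borel_measurable (lebesgue_on \<Omega>) \<Longrightarrow>
       (AE y in lebesgue_on \<Omega>. \<bar>h y\<bar> \<le> H) \<Longrightarrow> H \<ge> 0 \<Longrightarrow>
       \<bar>(LINT y|lebesgue_on \<Omega>. cutoff n (dist x y) * G x y * h y) - (LINT y|lebesgue_on \<Omega>. G x y * h y)\<bar>
         \<le> H * (c * (2 / real n) powr \<alpha>)"
    by (rule truncation_error, rule that, assumption+)
  let ?H = "Linf_norm \<Omega> \<beta> * sup_norm (closure \<Omega>) T v"
  let ?w = "\<lambda>n z. LINT y|lebesgue_on \<Omega>. cutoff n (dist (fst z) y) * G (fst z) y * (\<beta> y * v y (snd z))"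
  let ?l = "\<lambda>z. LINT y|lebesgue_on \<Omega>. G (fst z) y * (\<beta> y * v y (snd z))"
  have H: "?H \<ge> 0"
    using Linf_norm_nonneg[OF \<beta>] sup_norm_nonneg[OF compact_closure_domain T v] nonempty False by auto
  have "((\<lambda>n. (2 / real n) powr \<alpha>) \<longlongrightarrow> 0) sequentially"
  proof (rule tendsto_zero_powrI[where b = \<alpha>])
    show "(\<lambda>n. 2 / real n) \<longlonglongrightarrow> 0" by (rule lim_const_over_n)
  qed (use \<alpha> in auto)
  then have lim: "((\<lambda>n. ?H * (c * (2 / real n) powr \<alpha>)) \<longlongrightarrow> 0) sequentially"
    by (intro tendsto_mult_right_zero)
  have "uniform_limit (closure \<Omega> \<times> T) ?w ?l sequentially"
  proof (rule uniform_limitI)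
    fix e :: real assume "e > 0"
    have "\<forall>\<^sub>F n in sequentially. ?H * (c * (2 / real n) powr \<alpha>) < e"
      using lim \<open>e > 0\<close> by (rule order_tendstoD)
    then show "\<forall>\<^sub>F n in sequentially. \<forall>z\<in>closure \<Omega> \<times> T. dist (?w n z) (?l z) < e"
      using eventually_gt_at_top[of 0]
    proof eventually_elim
      case (elim n)
      show ?case
      proof
        fix z assume z: "z \<in> closure \<Omega> \<times> T"
        then have z': "fst z \<in> closure \<Omega>" "snd z \<in> T" by auto
        have "dist (?w n z) (?l z) \<le> ?H * (c * (2 / real n) powr \<alpha>)"
          unfolding dist_real_def
          by (rule err[OF elim(2) z'(1) coefficient_product[OF \<beta> v T z'(2)] H])
        with elim(1) show "dist (?w n z) (?l z) < e" by simp
      qed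
    qed
  qed
  then have "continuous_on (closure \<Omega> \<times> T) ?l"
    using truncated_potential_continuous[OF \<beta> v T]
    by (intro uniform_limit_theorem[where f = ?w and F = sequentially]) auto
  then have "continuous_on (closure \<Omega> \<times> T) (\<lambda>z. - (k\<^sup>2) * ?l z)" by (rule continuous_on_mult_left)
  then show ?thesis unfolding C_space_iff b_op_def by (simp add: mult.assoc)
qed (simp add: C_space_def)

text \<open>On the open domain the estimate is immediate from the definition of the supremum; continuity
  carries it to the closure.\<close>

lemma b_op_bound:
  assumes \<beta>: "\<beta> \<in> Linf \<Omega>" and v: "v \<in> C_space (closure \<Omega>) T" and T: "compact T"
    and x: "x \<in> closure \<Omega>" and s: "s \<in> T"
  shows "\<bar>b_op \<Omega> k G v \<beta> x s\<bar> \<le> k\<^sup>2 * (SUP x\<in>\<Omega>. LINT y|lebesgue_on \<Omega>. \<bar>G x y\<bar>)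
           * (Linf_norm \<Omega> \<beta> * sup_norm (closure \<Omega>) T v)"
proof (rule continuous_le_on_closure[OF _ x])
  have "continuous_on (closure \<Omega>) (\<lambda>x. b_op \<Omega> k G v \<beta> (fst (x, s)) (snd (x, s)))"
    by (rule continuous_on_compose2[OF b_op_C_space[OF \<beta> v T, unfolded C_space_iff]])
      (use s in \<open>auto intro!: continuous_intros\<close>)
  then show "continuous_on (closure \<Omega>) (\<lambda>x. \<bar>b_op \<Omega> k G v \<beta> x s\<bar>)"
    by (intro continuous_on_rabs) simp
next
  fix x assume x: "x \<in> \<Omega>"
  let ?I = "\<lambda>x. LINT y|lebesgue_on \<Omega>. \<bar>G x y\<bar>"
  let ?H = "Linf_norm \<Omega> \<beta> * sup_norm (closure \<Omega>) T v"
  have x': "x \<in> closure \<Omega>" using x closure_subset by auto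
  have H: "?H \<ge> 0"
    using nonempty s
    by (intro mult_nonneg_nonneg Linf_norm_nonneg[OF \<beta>] sup_norm_nonneg[OF compact_closure_domain T v]) auto
  obtain B where B: "\<And>x. x \<in> closure \<Omega> \<Longrightarrow> ?I x \<le> B" using kernel_L1_bound by metis
  have "bdd_above (?I ` \<Omega>)" using B closure_subset by (intro bdd_aboveI[of _ B]) auto
  then have "?I x \<le> (SUP x\<in>\<Omega>. ?I x)" using x by (intro cSUP_upper)
  then have "?H * ?I x \<le> ?H * (SUP x\<in>\<Omega>. ?I x)" using H by (intro mult_left_mono)
  then have "\<bar>LINT y|lebesgue_on \<Omega>. G x y * (\<beta> y * v y s)\<bar> \<le> ?H * (SUP x\<in>\<Omega>. ?I x)"
    using kernel_mult_bound[OF x' coefficient_product[OF \<beta> v T s]] by linarith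
  then have "k\<^sup>2 * \<bar>LINT y|lebesgue_on \<Omega>. G x y * (\<beta> y * v y s)\<bar> \<le> k\<^sup>2 * (?H * (SUP x\<in>\<Omega>. ?I x))"
    by (intro mult_left_mono) auto
  then show "\<bar>b_op \<Omega> k G v \<beta> x s\<bar> \<le> k\<^sup>2 * (SUP x\<in>\<Omega>. ?I x) * ?H"
    by (simp add: b_op_def abs_mult mult_ac)
qed

text \<open>If the supremum vanished, the kernel would vanish almost everywhere, hence by continuity
  everywhere off the diagonal.  The defining identity of the Green's function would then annihilate
  every test function.\<close>

lemma kernel_L1_pos:
  assumes "neumann_green \<Omega> k G"
  shows "0 < (SUP x\<in>\<Omega>. LINT y|lebesgue_on \<Omega>. \<bar>G x y\<bar>)"
proof (rule ccontr)
  let ?I = "\<lambda>x. LINT y|lebesgue_on \<Omega>. \<bar>G x y\<bar>"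
  assume "\<not> ?thesis"
  then have sup0: "(SUP x\<in>\<Omega>. ?I x) \<le> 0" by simp
  obtain B where B: "\<And>x. x \<in> closure \<Omega> \<Longrightarrow> ?I x \<le> B" using kernel_L1_bound by metis
  have bdd: "bdd_above (?I ` \<Omega>)" using B closure_subset by (intro bdd_aboveI[of _ B]) auto
  have G0: "G x y = 0" if x: "x \<in> \<Omega>" and y: "y \<in> \<Omega>" "y \<noteq> x" for x y
  proof -
    have x': "x \<in> closure \<Omega>" using x closure_subset by auto
    have "?I x \<le> 0" using cSUP_upper[OF x bdd] sup0 by simp
    moreover have "?I x \<ge> 0" by simp
    ultimately have "?I x = 0" by linarith
    then have "AE y in lebesgue_on \<Omega>. \<bar>G x y\<bar> = 0"
      using kernel_integrable[OF x'] by (subst (asm) integral_nonneg_eq_0_iff_AE) auto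
    then have "AE y in lebesgue. y \<in> \<Omega> \<longrightarrow> G x y = 0"
      by (subst (asm) AE_restrict_space_iff) (auto simp: domain_sets)
    then have "negligible {y. \<not> (y \<in> \<Omega> \<longrightarrow> G x y = 0)}"
      using negligible_subset by (force simp: negligible_iff_null_sets eventually_ae_filter)
    then have neg: "negligible {y \<in> \<Omega> - {x}. G x y \<noteq> 0}"
      by (rule negligible_subset) auto
    have "open {y \<in> \<Omega> - {x}. G x y \<in> - {0}}"
      using open_domain continuous_open_preimage[OF continuous_kernel[OF x'], of "- {0}"]
      by (auto simp: vimage_def Int_def open_Diff)
    then have "{y \<in> \<Omega> - {x}. G x y \<noteq> 0} = {}" using neg open_not_negligible by fastforce
    then show ?thesis using y by auto
  qed
  obtain p where p: "p \<in> \<Omega>" using nonempty by auto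
  obtain \<phi> where \<phi>: "test_function \<Omega> \<phi>" "\<phi> p \<noteq> 0" using test_function_exists[OF open_domain p] by blast
  have "\<phi> p = (LINT x|lebesgue_on \<Omega>. G x p * (laplacian \<phi> x + k\<^sup>2 * \<phi> x))"
    using assms p \<phi>(1) by (simp add: neumann_green_def)
  also have "\<dots> = 0"
  proof (rule integral_eq_zero_AE)
    have "AE x in lebesgue_on \<Omega>. x \<in> \<Omega>" by (rule AE_I2) simp
    then show "AE x in lebesgue_on \<Omega>. G x p * (laplacian \<phi> x + k\<^sup>2 * \<phi> x) = 0"
      using AE_neq[of p] by eventually_elim (use G0 p in auto)
  qed
  finally show False using \<phi>(2) by simp
qed

end

section \<open>Bounds for the forward operators\<close>

lemma finite_triples: "finite {(i, j, l). i + j + l = (n::nat)}"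
  by (rule finite_subset[of _ "{..n} \<times> {..n} \<times> {..n}"]) auto

text \<open>The Fuss-Catalan numbers: the recursion mirrors that of the forward operators, with every
  operator replaced by \<open>1\<close>.\<close>

function ternary_count :: "nat \<Rightarrow> real" where
  "ternary_count 0 = 1"
| "ternary_count (Suc n) = (\<Sum>(i, j, l)\<in>{(i, j, l). i + j + l = n}.
     ternary_count i * ternary_count j * ternary_count l)"
  by pat_completeness auto
termination by (relation "Wellfounded.measure (\<lambda>n. n)") auto

lemma ternary_count_nonneg: "0 \<le> ternary_count n"
proof (induction n rule: less_induct)
  case (less n)
  then show ?case by (cases n) (auto intro!: sum_nonneg)
qed

text \<open>The generating function solves \<open>A = 1 + z A ^ 3\<close>, with radius of convergence \<open>4 / 27\<close>.  At that
  radius \<open>3 / 2\<close> is a fixed point of \<open>s \<mapsto> 1 + z s ^ 3\<close>, and the partial sums starting from \<open>1\<close>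
  cannot cross it.\<close>

lemma ternary_count_partial_sum: "(\<Sum>n\<le>N. ternary_count n * (4 / 27) ^ n) \<le> 3 / 2"
proof (induction N)
  case (Suc N)
  define t where "t = (\<lambda>n. ternary_count n * (4 / 27) ^ n)"
  have t0: "t n \<ge> 0" for n using ternary_count_nonneg by (simp add: t_def)
  have tS: "t (Suc n) = 4 / 27 * (\<Sum>(i, j, l)\<in>{(i, j, l). i + j + l = n}. t i * t j * t l)" for n
    by (simp add: t_def sum_distrib_left sum_distrib_right)
      (auto simp: power_add intro!: sum.cong)
  have "(\<Sum>n\<le>N. \<Sum>(i, j, l)\<in>{(i, j, l). i + j + l = n}. t i * t j * t l)
      = (\<Sum>(i, j, l)\<in>(\<Union>n\<le>N. {(i, j, l). i + j + l = n}). t i * t j * t l)"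
    by (rule sum.UNION_disjoint[symmetric]) (auto simp: finite_triples)
  also have "\<dots> \<le> (\<Sum>(i, j, l)\<in>{..N} \<times> {..N} \<times> {..N}. t i * t j * t l)"
    by (rule sum_mono2) (auto simp: t0)
  also have "\<dots> = (\<Sum>i\<le>N. t i) ^ 3"
  proof -
    have "(\<Sum>(i, j, l)\<in>{..N} \<times> {..N} \<times> {..N}. t i * t j * t l) = (\<Sum>i\<le>N. \<Sum>j\<le>N. \<Sum>l\<le>N. t i * t j * t l)"
      by (simp add: sum.cartesian_product[symmetric])
    also have "\<dots> = (\<Sum>i\<le>N. t i) ^ 3"
      by (simp only: power3_eq_cube flip: sum_distrib_left sum_distrib_right)
    finally show ?thesis .
  qed
  also have "\<dots> \<le> (3 / 2) ^ 3"
    using Suc t0 by (intro power_mono) (auto simp: t_def intro!: sum_nonneg)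
  finally have le: "(\<Sum>n\<le>N. \<Sum>(i, j, l)\<in>{(i, j, l). i + j + l = n}. t i * t j * t l) \<le> (3 / 2) ^ 3" .
  have "(\<Sum>n\<le>Suc N. t n) = t 0 + (\<Sum>n\<le>N. t (Suc n))"
    by (rule sum.atMost_Suc_shift)
  also have "\<dots> = 1 + 4 / 27 * (\<Sum>n\<le>N. \<Sum>(i, j, l)\<in>{(i, j, l). i + j + l = n}. t i * t j * t l)"
    by (simp add: tS sum_distrib_left) (simp add: t_def)
  also have "\<dots> \<le> 1 + 4 / 27 * (3 / 2) ^ 3" using le by (intro add_left_mono mult_left_mono) auto
  also have "\<dots> = 3 / 2" by (simp add: power3_eq_cube)
  finally show ?case by (simp add: t_def)
qed simp

lemma ternary_count_bound: "ternary_count n \<le> 3 / 2 * (27 / 4) ^ n"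
proof -
  have "ternary_count n * (4 / 27) ^ n \<le> (\<Sum>m\<le>n. ternary_count m * (4 / 27) ^ m)"
    by (rule member_le_sum) (auto simp: ternary_count_nonneg)
  also note ternary_count_partial_sum
  finally have "ternary_count n * (4 / 27) ^ n * (27 / 4) ^ n \<le> 3 / 2 * (27 / 4) ^ n"
    by (intro mult_right_mono) auto
  moreover have "(4 / 27 :: real) ^ n * (27 / 4) ^ n = 1" by (simp flip: power_mult_distrib)
  ultimately show ?thesis by (simp add: mult.assoc)
qed

context weakly_singular_kernel
begin

text \<open>Continuity and the estimate are proved together, since the estimate for a potential needs a
  continuous density.\<close>

lemma forward_op_bound:
  fixes u\<^sub>0 :: "'a \<Rightarrow> 'a \<Rightarrow> real" and k :: real and T :: "'a set"
  defines "\<mu> \<equiv> k\<^sup>2 * (SUP x\<in>\<Omega>. LINT y|lebesgue_on \<Omega>. \<bar>G x y\<bar>)"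
    and "U \<equiv> sup_norm (closure \<Omega>) T u\<^sub>0"
  assumes u: "u\<^sub>0 \<in> C_space (closure \<Omega>) T" and T: "compact T" "T \<noteq> {}"
    and pos: "0 \<le> \<mu>"
    and \<beta>s: "length \<beta>s = n" "set \<beta>s \<subseteq> Linf \<Omega>"
  shows "forward_op \<Omega> k G u\<^sub>0 n \<beta>s \<in> C_space (closure \<Omega>) T \<and>
    (\<forall>x\<in>closure \<Omega>. \<forall>s\<in>T. \<bar>forward_op \<Omega> k G u\<^sub>0 n \<beta>s x s\<bar>
       \<le> ternary_count n * \<mu> ^ n * U ^ (2 * n + 1) * (\<Prod>\<beta>\<leftarrow>\<beta>s. Linf_norm \<Omega> \<beta>))"
  using \<beta>s
proof (induction n arbitrary: \<beta>s rule: less_induct)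
  case (less n)
  let ?K = "forward_op \<Omega> k G u\<^sub>0" and ?P = "\<lambda>\<beta>s. \<Prod>\<beta>\<leftarrow>\<beta>s. Linf_norm \<Omega> \<beta>"
  have U: "U \<ge> 0"
    unfolding U_def using sup_norm_nonneg[OF compact_closure_domain T(1) u] nonempty T(2) by simp
  have P0: "?P \<beta>s \<ge> 0" if "set \<beta>s \<subseteq> Linf \<Omega>" for \<beta>s
    using that Linf_norm_nonneg by (induction \<beta>s) auto
  show ?case
  proof (cases n)
    case 0
    then show ?thesis
      using u sup_norm_upper[OF compact_closure_domain T(1) u] less.prems by (simp add: U_def)
  next
    case (Suc m)
    define bs where "bs = butlast \<beta>s"
    define b where "b = last \<beta>s"
    have "\<beta>s \<noteq> []" using less.prems Suc by auto
    then have eq: "\<beta>s = bs @ [b]" by (simp add: bs_def b_def)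
    have b: "b \<in> Linf \<Omega>" and bs: "set bs \<subseteq> Linf \<Omega>" "length bs = m"
      using less.prems Suc by (auto simp: eq)
    define I where "I = {(i, j, l). i + j + l = m}"
    define w where "w = (\<lambda>x s. \<Sum>(i, j, l)\<in>I.
       tensor_op i (?K i) (tensor_op j (?K j) (?K l)) bs x s)"
    have K: "?K n \<beta>s = b_op \<Omega> k G w b"
      unfolding Suc forward_op.simps(2) B_op_def bs_def[symmetric] b_def[symmetric]
      unfolding w_def I_def ..
    let ?c = "\<lambda>n. ternary_count n * \<mu> ^ n * U ^ (2 * n + 1)"
    have summand: "(\<lambda>x s. tensor_op i (?K i) (tensor_op j (?K j) (?K l)) bs x s) \<in> C_space (closure \<Omega>) T \<and>
        (\<forall>x\<in>closure \<Omega>. \<forall>s\<in>T. \<bar>tensor_op i (?K i) (tensor_op j (?K j) (?K l)) bs x s\<bar>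
          \<le> (ternary_count i * ternary_count j * ternary_count l) * (\<mu> ^ m * U ^ (2 * m + 3) * ?P bs))"
      if ijl: "i + j + l = m" for i j l
    proof -
      define b1 b2 b3 where "b1 = take i bs" and "b2 = take j (drop i bs)" and "b3 = drop j (drop i bs)"
      have len: "length b1 = i" "length b2 = j" "length b3 = l"
        using ijl bs by (auto simp: b1_def b2_def b3_def)
      have sub: "set b1 \<subseteq> Linf \<Omega>" "set b2 \<subseteq> Linf \<Omega>" "set b3 \<subseteq> Linf \<Omega>"
        using bs(1) by (auto simp: b1_def b2_def b3_def dest!: in_set_takeD in_set_dropD)
      have "bs = b1 @ b2 @ b3" unfolding b1_def b2_def b3_def by (simp only: append_take_drop_id)
      then have P: "?P bs = ?P b1 * ?P b2 * ?P b3" by simp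
      have less: "i < n" "j < n" "l < n" using ijl Suc by auto
      note IH1 = less.IH[OF less(1) len(1) sub(1)]
      note IH2 = less.IH[OF less(2) len(2) sub(2)]
      note IH3 = less.IH[OF less(3) len(3) sub(3)]
      have t: "tensor_op i (?K i) (tensor_op j (?K j) (?K l)) bs x s
          = ?K i b1 x s * (?K j b2 x s * ?K l b3 x s)" for x s
        by (simp add: tensor_op_def b1_def b2_def b3_def)
      have "\<bar>?K i b1 x s * (?K j b2 x s * ?K l b3 x s)\<bar>
          \<le> (?c i * ?P b1) * ((?c j * ?P b2) * (?c l * ?P b3))" if "x \<in> closure \<Omega>" "s \<in> T" for x s
        unfolding abs_mult using IH1 IH2 IH3 that U pos P0[OF sub(1)] P0[OF sub(2)] P0[OF sub(3)] ternary_count_nonneg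
        by (intro mult_mono mult_nonneg_nonneg) auto
      also have "(?c i * ?P b1) * ((?c j * ?P b2) * (?c l * ?P b3))
        = (ternary_count i * ternary_count j * ternary_count l) * (\<mu> ^ m * U ^ (2 * m + 3) * ?P bs)"
      proof -
        have "\<mu> ^ m = \<mu> ^ i * \<mu> ^ j * \<mu> ^ l" using ijl by (auto simp: power_add)
        moreover have "2 * m + 3 = (2 * i + 1) + (2 * j + 1) + (2 * l + 1)" using ijl by auto
        then have "U ^ (2 * m + 3) = U ^ (2 * i + 1) * U ^ (2 * j + 1) * U ^ (2 * l + 1)"
          by (simp only: power_add)
        ultimately show ?thesis unfolding P by (simp only: mult_ac)
      qed
      finally show ?thesis
        unfolding t using IH1 IH2 IH3 by (auto intro: C_space_mult)
    qed
    have w: "w \<in> C_space (closure \<Omega>) T"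
      unfolding w_def case_prod_unfold by (rule C_space_sum) (use summand in \<open>auto simp: I_def\<close>)
    have "sup_norm (closure \<Omega>) T w \<le> ternary_count (Suc m) * (\<mu> ^ m * U ^ (2 * m + 3) * ?P bs)"
    proof (rule sup_norm_least)
      fix x s assume x: "x \<in> closure \<Omega>" and s: "s \<in> T"
      have "\<bar>w x s\<bar> \<le> (\<Sum>(i, j, l)\<in>I. \<bar>tensor_op i (?K i) (tensor_op j (?K j) (?K l)) bs x s\<bar>)"
        unfolding w_def case_prod_unfold by (rule sum_abs)
      also have "\<dots> \<le> (\<Sum>(i, j, l)\<in>I. (ternary_count i * ternary_count j * ternary_count l)
            * (\<mu> ^ m * U ^ (2 * m + 3) * ?P bs))"
        unfolding case_prod_unfold
        by (rule sum_mono) (use summand x s in \<open>auto simp: I_def\<close>)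
      also have "\<dots> = ternary_count (Suc m) * (\<mu> ^ m * U ^ (2 * m + 3) * ?P bs)"
        by (simp add: I_def sum_distrib_right case_prod_unfold)
      finally show "\<bar>w x s\<bar> \<le> ternary_count (Suc m) * (\<mu> ^ m * U ^ (2 * m + 3) * ?P bs)" .
    qed (use nonempty T in auto)
    then have "\<mu> * (Linf_norm \<Omega> b * sup_norm (closure \<Omega>) T w)
        \<le> \<mu> * (Linf_norm \<Omega> b * (ternary_count (Suc m) * (\<mu> ^ m * U ^ (2 * m + 3) * ?P bs)))"
      using pos Linf_norm_nonneg[OF b] by (intro mult_left_mono)
    also have "\<dots> = ?c n * ?P \<beta>s"
      unfolding Suc eq by (simp add: mult_ac power_add numeral_3_eq_3 del: ternary_count.simps)
    finally have le: "\<mu> * (Linf_norm \<Omega> b * sup_norm (closure \<Omega>) T w) \<le> ?c n * ?P \<beta>s" .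
    have "\<bar>b_op \<Omega> k G w b x s\<bar> \<le> ?c n * ?P \<beta>s" if "x \<in> closure \<Omega>" "s \<in> T" for x s
      using b_op_bound[OF b w T(1) that, of k] le unfolding \<mu>_def[symmetric] by (rule order_trans)
    then show ?thesis unfolding K using b_op_C_space[OF b w T(1)] by blast
  qed
qed

end

lemma (in weakly_singular_kernel) forward_op_geometric:
  fixes u\<^sub>0 :: "'a \<Rightarrow> 'a \<Rightarrow> real" and k :: real
  defines "\<mu> \<equiv> k\<^sup>2 * (SUP x\<in>\<Omega>. LINT y|lebesgue_on \<Omega>. \<bar>G x y\<bar>)"
    and "U \<equiv> sup_norm (closure \<Omega>) (frontier \<Omega>) u\<^sub>0"
  assumes u: "u\<^sub>0 \<in> C_space (closure \<Omega>) (frontier \<Omega>)" and pos: "0 \<le> \<mu>"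
    and \<beta>s: "length \<beta>s = n" "set \<beta>s \<subseteq> Linf \<Omega>"
  shows "forward_op \<Omega> k G u\<^sub>0 n \<beta>s \<in> C_space (frontier \<Omega>) (frontier \<Omega>) \<and>
    sup_norm (frontier \<Omega>) (frontier \<Omega>) (forward_op \<Omega> k G u\<^sub>0 n \<beta>s)
       \<le> (3 / 2 * U) * (27 / 4 * \<mu> * U\<^sup>2) ^ n * (\<Prod>\<beta>\<leftarrow>\<beta>s. Linf_norm \<Omega> \<beta>)"
proof -
  let ?K = "forward_op \<Omega> k G u\<^sub>0 n \<beta>s" and ?P = "\<Prod>\<beta>\<leftarrow>\<beta>s. Linf_norm \<Omega> \<beta>"
  have *: "?K \<in> C_space (closure \<Omega>) (frontier \<Omega>)"
    "\<And>x s. x \<in> closure \<Omega> \<Longrightarrow> s \<in> frontier \<Omega> \<Longrightarrow>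
      \<bar>?K x s\<bar> \<le> ternary_count n * \<mu> ^ n * U ^ (2 * n + 1) * ?P"
    using forward_op_bound[OF u compact_frontier_domain frontier_nonempty pos[unfolded \<mu>_def] \<beta>s]
    unfolding \<mu>_def U_def by auto
  have sub: "frontier \<Omega> \<subseteq> closure \<Omega>" by (auto simp: frontier_def)
  have U: "U \<ge> 0"
    unfolding U_def using nonempty
    by (intro sup_norm_nonneg compact_closure_domain compact_frontier_domain frontier_nonempty u) auto
  have P: "?P \<ge> 0" using \<beta>s(2) Linf_norm_nonneg by (induction \<beta>s) auto
  have "ternary_count n * (\<mu> ^ n * U ^ (2 * n + 1) * ?P) \<le> 3 / 2 * (27 / 4) ^ n * (\<mu> ^ n * U ^ (2 * n + 1) * ?P)"
    using ternary_count_bound U P pos by (intro mult_right_mono) auto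
  also have "\<dots> = (3 / 2 * U) * (27 / 4 * \<mu> * U\<^sup>2) ^ n * ?P"
  proof -
    have "U ^ (2 * n + 1) = (U\<^sup>2) ^ n * U" by (simp add: power_mult)
    then show ?thesis by (simp only: power_mult_distrib mult_ac)
  qed
  finally have "ternary_count n * \<mu> ^ n * U ^ (2 * n + 1) * ?P \<le> (3 / 2 * U) * (27 / 4 * \<mu> * U\<^sup>2) ^ n * ?P"
    by (simp only: mult.assoc)
  then have "sup_norm (frontier \<Omega>) (frontier \<Omega>) ?K \<le> (3 / 2 * U) * (27 / 4 * \<mu> * U\<^sup>2) ^ n * ?P"
    using * sub by (intro sup_norm_least frontier_nonempty) (meson order_trans subsetD)
  then show ?thesis using C_space_mono[OF *(1) sub] by blast
qed

section \<open>Convergence of the inverse series\<close>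

text \<open>The expansion of a power of a sum into monomials.\<close>

lemma sum_prod_list_power:
  fixes f :: "'b \<Rightarrow> real"
  assumes "finite A"
  shows "(\<Sum>xs\<in>{xs. set xs \<subseteq> A \<and> length xs = n}. \<Prod>x\<leftarrow>xs. f x) = (\<Sum>x\<in>A. f x) ^ n"
proof (induction n)
  case 0
  have "{xs. set xs \<subseteq> A \<and> length xs = 0} = {[]}" by auto
  then show ?case by simp
next
  case (Suc n)
  let ?L = "\<lambda>n. {xs. set xs \<subseteq> A \<and> length xs = n}"
  have "?L (Suc n) = (\<lambda>(x, xs). x # xs) ` (A \<times> ?L n)"
    by (auto simp: length_Suc_conv image_iff)
  then have "(\<Sum>xs\<in>?L (Suc n). \<Prod>x\<leftarrow>xs. f x) = (\<Sum>(x, xs)\<in>A \<times> ?L n. f x * (\<Prod>x\<leftarrow>xs. f x))"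
    by (simp add: sum.reindex inj_on_def case_prod_unfold)
  also have "\<dots> = (\<Sum>x\<in>A. f x) * (\<Sum>xs\<in>?L n. \<Prod>x\<leftarrow>xs. f x)"
    by (simp add: sum_product sum.cartesian_product)
  finally show ?case using Suc by simp
qed

lemma finite_compositions: "finite (compositions n m)"
proof (rule finite_subset)
  show "compositions n m \<subseteq> {is. set is \<subseteq> {..m} \<and> length is = n}"
    by (auto simp: compositions_def dest: member_le_sum_list)
qed (simp add: finite_lists_length_eq)

text \<open>A composition of \<open>m \<le> N + 1\<close> into at least two positive parts has parts at most \<open>N\<close>, so its
  monomial occurs in the expansion of the power; different \<open>m\<close> have different compositions.\<close>

lemma sum_compositions_le:
  fixes s :: "nat \<Rightarrow> real"
  assumes s: "\<And>i. i \<ge> 1 \<Longrightarrow> s i \<ge> 0" and "n \<ge> 2"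
  shows "(\<Sum>m=2..Suc N. \<Sum>is\<in>compositions n m. \<Prod>i\<leftarrow>is. s i) \<le> (\<Sum>i=1..N. s i) ^ n"
proof -
  have "(\<Sum>m=2..Suc N. \<Sum>is\<in>compositions n m. \<Prod>i\<leftarrow>is. s i)
      = (\<Sum>is\<in>(\<Union>m\<in>{2..Suc N}. compositions n m). \<Prod>i\<leftarrow>is. s i)"
    by (rule sum.UNION_disjoint[symmetric])
      (simp_all add: finite_compositions, auto simp: compositions_def)
  also have "\<dots> \<le> (\<Sum>is\<in>{is. set is \<subseteq> {1..N} \<and> length is = n}. \<Prod>i\<leftarrow>is. s i)"
  proof (rule sum_mono2)
    show "(\<Union>m\<in>{2..Suc N}. compositions n m) \<subseteq> {is. set is \<subseteq> {1..N} \<and> length is = n}"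
    proof
      fix "is" assume "is \<in> (\<Union>m\<in>{2..Suc N}. compositions n m)"
      then obtain m where m: "m \<le> Suc N" "is \<in> compositions n m" by auto
      then have "1 \<le> i \<and> i \<le> N" if "i \<in> set is" for i
        using compositions_less[OF m(2) assms(2) that] that by (auto simp: compositions_def)
      then show "is \<in> {is. set is \<subseteq> {1..N} \<and> length is = n}" using m(2) by (auto simp: compositions_def)
    qed
    fix "is" assume "is \<in> {is. set is \<subseteq> {1..N} \<and> length is = n} - (\<Union>m\<in>{2..Suc N}. compositions n m)"
    then have "set is \<subseteq> {1..N}" by simp
    then show "0 \<le> (\<Prod>i\<leftarrow>is. s i)" using s by (induction "is") auto
  qed (simp add: finite_lists_length_eq)
  also have "\<dots> = (\<Sum>i=1..N. s i) ^ n" by (rule sum_prod_list_power) simp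
  finally show ?thesis .
qed

lemma sum_powers_from_2_le:
  fixes w :: real
  assumes "0 \<le> w" "w < 1"
  shows "(\<Sum>n=2..N. w ^ n) \<le> w\<^sup>2 / (1 - w)"
proof (cases "N \<ge> 2")
  case True
  then have "(1 - w) * (\<Sum>n=2..N. w ^ n) = w\<^sup>2 - w ^ Suc N" by (rule sum_gp_multiplied)
  also have "\<dots> \<le> w\<^sup>2" using assms by simp
  finally show ?thesis using assms by (simp add: field_simps)
qed (use assms in simp)

lemma inverse_op_1: "inverse_op K A 1 \<phi> = A \<phi>"
  by (subst inverse_op.simps) simp

lemma inverse_op_step:
  assumes "m \<ge> 2"
  shows "inverse_op K A m \<phi> = (\<lambda>y. - (\<Sum>n\<in>{2..m}. \<Sum>is\<in>compositions n m.
                     A (K n (map (\<lambda>i. inverse_op K A i \<phi>) is)) y))"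
  using assms by (subst inverse_op.simps) auto

text \<open>The defining equation has no constructor pattern on its left-hand side and would be unfolded
  forever.\<close>

declare inverse_op.simps [simp del]

text \<open>The left-hand side is \<open>\<kappa>\<close> times the stated radius.  It equals half the inverse of
  \<open>sqrt (16 C\<^sup>2 + 1) + 4 C\<close>, so for large \<open>C\<close> little is lost.\<close>

lemma sqrt_radius_bound:
  fixes C :: real
  assumes "C > 0"
  shows "(sqrt (16 * C\<^sup>2 + 1) - 4 * C) / 2 \<le> 1 / (16 * C)"
proof -
  have "16 * C\<^sup>2 + 1 \<le> (4 * C + 1 / (8 * C))\<^sup>2"
    using assms by (simp add: power2_sum)
  then have "sqrt (16 * C\<^sup>2 + 1) \<le> 4 * C + 1 / (8 * C)"
    using assms by (intro real_le_lsqrt) auto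
  then show ?thesis using assms by (simp add: field_simps)
qed

text \<open>With \<open>C \<ge> 2\<close> the whole interval lies below \<open>1 / 16\<close>, where the quadratic term contributes no
  more than \<open>1 / (60 C)\<close>; the linear term takes up at most half of the bound.\<close>

lemma majorant_invariant:
  fixes C M w x :: real
  assumes C: "C \<ge> 2" and M: "0 \<le> M" "M \<le> C" and w: "0 \<le> w" "w \<le> 1 / (8 * C)" and x: "x \<le> 1 / (16 * C)"
  shows "x + M * (w\<^sup>2 / (1 - w)) \<le> 1 / (8 * C)"
proof -
  have w16: "w \<le> 1 / 16"
  proof -
    have "1 / (8 * C) \<le> 1 / 16" using C by (intro divide_left_mono) auto
    then show ?thesis using w by linarith
  qed
  have "w\<^sup>2 / (1 - w) \<le> (1 / (8 * C))\<^sup>2 / (15 / 16)"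
    using w w16 by (intro frac_le power_mono) auto
  then have "M * (w\<^sup>2 / (1 - w)) \<le> C * ((1 / (8 * C))\<^sup>2 / (15 / 16))"
    using M C w w16 by (intro mult_mono) auto
  also have "\<dots> = 1 / (60 * C)" using C by (simp add: power2_eq_square field_simps)
  also have "\<dots> \<le> 1 / (16 * C)" using C by (intro divide_left_mono) auto
  finally have "x + M * (w\<^sup>2 / (1 - w)) \<le> 1 / (16 * C) + 1 / (16 * C)" using x by simp
  also have "\<dots> = 1 / (8 * C)" by simp
  finally show ?thesis .
qed

context bounded_domain
begin

text \<open>Membership and the recursive estimate: the recursion passes the earlier terms to the forward
  operators, so their membership is the induction hypothesis that makes the new term meaningful.\<close>

lemma inverse_op_norm_bound:
  fixes K :: "nat \<Rightarrow> 'a mult_op" and \<nu> \<kappa> :: real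
  assumes A: "bounded_linear_C_Linf \<Omega> A"
    and \<phi>: "\<phi> \<in> C_space (frontier \<Omega>) (frontier \<Omega>)"
    and K: "\<And>n \<beta>s. length \<beta>s = n \<Longrightarrow> set \<beta>s \<subseteq> Linf \<Omega> \<Longrightarrow>
      K n \<beta>s \<in> C_space (frontier \<Omega>) (frontier \<Omega>) \<and>
      sup_norm (frontier \<Omega>) (frontier \<Omega>) (K n \<beta>s) \<le> \<nu> * \<kappa> ^ n * (\<Prod>\<beta>\<leftarrow>\<beta>s. Linf_norm \<Omega> \<beta>)"
    and "m \<ge> 1"
  shows "inverse_op K A m \<phi> \<in> Linf \<Omega>"
    and "m \<ge> 2 \<Longrightarrow> Linf_norm \<Omega> (inverse_op K A m \<phi>) \<le> (\<Sum>n\<in>{2..m}. \<Sum>is\<in>compositions n m.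
       op_norm \<Omega> A * \<nu> * \<kappa> ^ n * (\<Prod>i\<leftarrow>is. Linf_norm \<Omega> (inverse_op K A i \<phi>)))"
proof -
  let ?\<beta> = "\<lambda>i. inverse_op K A i \<phi>"
  have AL: "A \<psi> \<in> Linf \<Omega>" if "\<psi> \<in> C_space (frontier \<Omega>) (frontier \<Omega>)" for \<psi>
    using A that by (simp add: bounded_linear_C_Linf_def)
  have *: "?\<beta> m \<in> Linf \<Omega> \<and> (m \<ge> 2 \<longrightarrow> Linf_norm \<Omega> (?\<beta> m) \<le> (\<Sum>n\<in>{2..m}. \<Sum>is\<in>compositions n m.
       op_norm \<Omega> A * \<nu> * \<kappa> ^ n * (\<Prod>i\<leftarrow>is. Linf_norm \<Omega> (?\<beta> i))))"
    using \<open>m \<ge> 1\<close>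
  proof (induction m rule: less_induct)
    case (less m)
    show ?case
    proof (cases "m = 1")
      case True
      then show ?thesis using AL[OF \<phi>] by (simp add: inverse_op_1[unfolded One_nat_def])
    next
      case False
      then have m2: "m \<ge> 2" using less.prems by simp
      let ?t = "\<lambda>n is. A (K n (map ?\<beta> is))"
      have t: "?t n is \<in> Linf \<Omega>" "Linf_norm \<Omega> (?t n is) \<le> op_norm \<Omega> A * \<nu> * \<kappa> ^ n * (\<Prod>i\<leftarrow>is. Linf_norm \<Omega> (?\<beta> i))"
        if n: "n \<in> {2..m}" and "is": "is \<in> compositions n m" for n "is"
      proof -
        have len: "length (map ?\<beta> is) = n" using "is" by (simp add: compositions_def)
        have "?\<beta> i \<in> Linf \<Omega>" if "i \<in> set is" for i
          using less.IH[of i] compositions_less[OF "is" _ that] that n "is" by (auto simp: compositions_def)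
        then have sub: "set (map ?\<beta> is) \<subseteq> Linf \<Omega>" by auto
        note Kn = K[OF len sub]
        show "?t n is \<in> Linf \<Omega>" using Kn by (intro AL) simp
        have "Linf_norm \<Omega> (?t n is) \<le> op_norm \<Omega> A * sup_norm (frontier \<Omega>) (frontier \<Omega>) (K n (map ?\<beta> is))"
          using Kn by (intro op_norm_bound[OF A]) simp
        also have "\<dots> \<le> op_norm \<Omega> A * (\<nu> * \<kappa> ^ n * (\<Prod>\<beta>\<leftarrow>map ?\<beta> is. Linf_norm \<Omega> \<beta>))"
          using Kn by (intro mult_left_mono op_norm_nonneg[OF A]) simp
        finally show "Linf_norm \<Omega> (?t n is) \<le> op_norm \<Omega> A * \<nu> * \<kappa> ^ n * (\<Prod>i\<leftarrow>is. Linf_norm \<Omega> (?\<beta> i))"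
          by (simp add: comp_def mult.assoc)
      qed
      let ?S = "\<lambda>y. \<Sum>n\<in>{2..m}. \<Sum>is\<in>compositions n m. ?t n is y"
      have inner: "(\<lambda>y. \<Sum>is\<in>compositions n m. ?t n is y) \<in> Linf \<Omega>" if "n \<in> {2..m}" for n
        using t(1)[OF that] by (intro Linf_sum finite_compositions)
      have S: "?S \<in> Linf \<Omega>" by (rule Linf_sum[OF inner]) auto
      have eq: "?\<beta> m = (\<lambda>y. (- 1) * ?S y)" unfolding inverse_op_step[OF m2] by simp
      have "Linf_norm \<Omega> (?\<beta> m) \<le> Linf_norm \<Omega> ?S"
        unfolding eq using Linf_norm_cmult_le[OF S, of "- 1"] by simp
      also have "\<dots> \<le> (\<Sum>n\<in>{2..m}. Linf_norm \<Omega> (\<lambda>y. \<Sum>is\<in>compositions n m. ?t n is y))"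
        by (rule Linf_norm_sum_le[OF inner]) auto
      also have "\<dots> \<le> (\<Sum>n\<in>{2..m}. \<Sum>is\<in>compositions n m. Linf_norm \<Omega> (?t n is))"
        using t(1) by (intro sum_mono Linf_norm_sum_le finite_compositions)
      also have "\<dots> \<le> (\<Sum>n\<in>{2..m}. \<Sum>is\<in>compositions n m.
          op_norm \<Omega> A * \<nu> * \<kappa> ^ n * (\<Prod>i\<leftarrow>is. Linf_norm \<Omega> (?\<beta> i)))"
        using t(2) by (intro sum_mono)
      finally show ?thesis using Linf_cmult[OF S, of "- 1"] unfolding eq by blast
    qed
  qed
  show "?\<beta> m \<in> Linf \<Omega>" using * by blast
  show "m \<ge> 2 \<Longrightarrow> Linf_norm \<Omega> (?\<beta> m) \<le> (\<Sum>n\<in>{2..m}. \<Sum>is\<in>compositions n m.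
       op_norm \<Omega> A * \<nu> * \<kappa> ^ n * (\<Prod>i\<leftarrow>is. Linf_norm \<Omega> (?\<beta> i)))" using * by blast
qed

text \<open>The threshold \<open>1 / (2 \<kappa>) (sqrt (16 C\<^sup>2 + 1) - 4 C)\<close> is used only through \<open>1 / (16 C \<kappa>)\<close>.
  The induction shows that the partial sums of the norms, scaled by \<open>\<kappa>\<close>, never leave the interval
  that is invariant under the majorant.\<close>

lemma inverse_series_converges:
  fixes K :: "nat \<Rightarrow> 'a mult_op" and \<nu> \<kappa> C :: real
  assumes A: "bounded_linear_C_Linf \<Omega> A"
    and \<phi>: "\<phi> \<in> C_space (frontier \<Omega>) (frontier \<Omega>)"
    and K: "\<And>n \<beta>s. length \<beta>s = n \<Longrightarrow> set \<beta>s \<subseteq> Linf \<Omega> \<Longrightarrow>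
      K n \<beta>s \<in> C_space (frontier \<Omega>) (frontier \<Omega>) \<and>
      sup_norm (frontier \<Omega>) (frontier \<Omega>) (K n \<beta>s) \<le> \<nu> * \<kappa> ^ n * (\<Prod>\<beta>\<leftarrow>\<beta>s. Linf_norm \<Omega> \<beta>)"
    and pos: "\<kappa> > 0" "\<nu> \<ge> 0"
    and C: "C = max 2 (op_norm \<Omega> A * \<nu> * \<kappa>)"
    and small: "Linf_norm \<Omega> (A \<phi>) < 1 / (2 * \<kappa>) * (sqrt (16 * C\<^sup>2 + 1) - 4 * C)"
  shows "series_converges_Linf \<Omega> (\<lambda>m. inverse_op K A m \<phi>)"
proof -
  let ?\<beta> = "\<lambda>m. inverse_op K A m \<phi>"
  define s where "s = (\<lambda>m. Linf_norm \<Omega> (?\<beta> m))"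
  define a where "a = op_norm \<Omega> A * \<nu>"
  have a: "a \<ge> 0" using op_norm_nonneg[OF A] pos by (simp add: a_def)
  have L: "m \<ge> 1 \<Longrightarrow> ?\<beta> m \<in> Linf \<Omega>" for m by (rule inverse_op_norm_bound(1)[OF A \<phi> K])
  have s0: "m \<ge> 1 \<Longrightarrow> s m \<ge> 0" for m using Linf_norm_nonneg[OF L] by (simp add: s_def)
  have C2: "C \<ge> 2" using C by simp
  have "s 1 * \<kappa> \<le> (sqrt (16 * C\<^sup>2 + 1) - 4 * C) / 2"
    using small pos by (simp add: s_def inverse_op_1[unfolded One_nat_def] field_simps)
  also have "\<dots> \<le> 1 / (16 * C)" using C2 by (intro sqrt_radius_bound) simp
  finally have s1: "\<kappa> * s 1 \<le> 1 / (16 * C)" by (simp add: mult.commute)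
  have partial: "\<kappa> * (\<Sum>m=1..N. s m) \<le> 1 / (8 * C)" for N
  proof (induction N)
    case 0
    show ?case using C2 by simp
  next
    case (Suc N)
    define w where "w = \<kappa> * (\<Sum>m=1..N. s m)"
    have w0: "w \<ge> 0" unfolding w_def using pos s0 by (intro mult_nonneg_nonneg sum_nonneg) auto
    have "1 / (8 * C) \<le> 1 / 16" using C2 by (intro divide_left_mono) auto
    then have w1: "w < 1" using Suc unfolding w_def by linarith
    have "(\<Sum>m=1..Suc N. s m) = s 1 + (\<Sum>m=2..Suc N. s m)"
      by (subst sum.atLeast_Suc_atMost) (auto simp: numeral_2_eq_2)
    also have "(\<Sum>m=2..Suc N. s m)
        \<le> (\<Sum>m=2..Suc N. \<Sum>n=2..m. \<Sum>is\<in>compositions n m. a * \<kappa> ^ n * (\<Prod>i\<leftarrow>is. s i))"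
    proof (rule sum_mono)
      fix m assume "m \<in> {2..Suc N}"
      then show "s m \<le> (\<Sum>n=2..m. \<Sum>is\<in>compositions n m. a * \<kappa> ^ n * (\<Prod>i\<leftarrow>is. s i))"
        using inverse_op_norm_bound(2)[OF A \<phi> K, of m] by (simp add: s_def a_def)
    qed
    \<comment> \<open>Extending the range of \<open>n\<close> makes it independent of \<open>m\<close>, so that the sums can be exchanged.\<close>
    also have "\<dots> \<le> (\<Sum>m=2..Suc N. \<Sum>n=2..Suc N. \<Sum>is\<in>compositions n m. a * \<kappa> ^ n * (\<Prod>i\<leftarrow>is. s i))"
    proof (intro sum_mono sum_mono2)
      fix m n assume "m \<in> {2..Suc N}" "n \<in> {2..Suc N} - {2..m}"
      have "0 \<le> (\<Prod>i\<leftarrow>is. s i)" if "is \<in> compositions n m" for "is"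
      proof -
        have "\<forall>i\<in>set is. 1 \<le> i" using that by (simp add: compositions_def)
        then show ?thesis using s0 by (induction "is") auto
      qed
      then show "0 \<le> (\<Sum>is\<in>compositions n m. a * \<kappa> ^ n * (\<Prod>i\<leftarrow>is. s i))"
        using a pos by (intro sum_nonneg mult_nonneg_nonneg) auto
    qed auto
    also have "\<dots> = (\<Sum>n=2..Suc N. a * \<kappa> ^ n * (\<Sum>m=2..Suc N. \<Sum>is\<in>compositions n m. \<Prod>i\<leftarrow>is. s i))"
      unfolding sum_distrib_left by (rule sum.swap)
    also have "\<dots> \<le> (\<Sum>n=2..Suc N. a * \<kappa> ^ n * (\<Sum>i=1..N. s i) ^ n)"
      using a pos s0 by (intro sum_mono mult_left_mono sum_compositions_le) auto
    also have "\<dots> = a * (\<Sum>n=2..Suc N. w ^ n)"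
      unfolding w_def power_mult_distrib by (simp only: sum_distrib_left mult.assoc)
    also have "\<dots> \<le> a * (w\<^sup>2 / (1 - w))"
      using sum_powers_from_2_le[OF w0 w1] a by (rule mult_left_mono)
    finally have "(\<Sum>m=1..Suc N. s m) \<le> s 1 + a * (w\<^sup>2 / (1 - w))" by simp
    then have "\<kappa> * (\<Sum>m=1..Suc N. s m) \<le> \<kappa> * s 1 + (a * \<kappa>) * (w\<^sup>2 / (1 - w))"
      using pos mult_left_mono[of _ _ \<kappa>] by (fastforce simp: algebra_simps)
    also have "\<dots> \<le> 1 / (8 * C)"
    proof (rule majorant_invariant[OF C2 _ _ w0 _ s1])
      show "0 \<le> a * \<kappa>" using a pos by simp
      show "a * \<kappa> \<le> C" using C by (simp add: a_def)
      show "w \<le> 1 / (8 * C)" using Suc by (simp add: w_def)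
    qed
    finally show ?case .
  qed
  show ?thesis
  proof (rule series_converges_LinfI[OF L])
    show "(\<Sum>m=1..N. Linf_norm \<Omega> (?\<beta> m)) \<le> 1 / (8 * C) / \<kappa>" for N
      using partial[of N] unfolding s_def by (subst pos_le_divide_eq[OF pos(1)]) (simp add: mult.commute)
  qed
qed

end

section \<open>Scaling of the background field\<close>

lemma forward_op_1_cmult:
  "forward_op \<Omega> k G (\<lambda>x s. \<gamma> * u\<^sub>0 x s) 1 [\<beta>] x s = \<gamma> ^ 3 * forward_op \<Omega> k G u\<^sub>0 1 [\<beta>] x s"
proof -
  have triples: "{(i, j, l). i + j + l = (0::nat)} = {(0, 0, 0)}" by auto
  have "forward_op \<Omega> k G v 1 [\<beta>] x s = - (k\<^sup>2) * (LINT y|lebesgue_on \<Omega>. G x y * \<beta> y * v y s ^ 3)" for v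
    by (simp add: One_nat_def triples B_op_def b_op_def tensor_op_def power3_eq_cube mult.assoc)
  moreover have "(LINT y|lebesgue_on \<Omega>. G x y * \<beta> y * (\<gamma> * u\<^sub>0 y s) ^ 3)
      = \<gamma> ^ 3 * (LINT y|lebesgue_on \<Omega>. G x y * \<beta> y * u\<^sub>0 y s ^ 3)"
    by (subst integral_mult_right_zero[symmetric]) (simp add: power_mult_distrib mult_ac)
  ultimately show ?thesis by simp
qed

theorem mainTheorem5:
  fixes \<Omega> :: "'a::euclidean_space set" and k :: real
    and G :: "'a \<Rightarrow> 'a \<Rightarrow> real"
    and g :: "'a \<Rightarrow> 'a \<Rightarrow> real" and u\<^sub>0 :: "'a \<Rightarrow> 'a \<Rightarrow> real"
    and \<K>\<^sub>1 :: "('a \<Rightarrow> 'a \<Rightarrow> real) \<Rightarrow> 'a \<Rightarrow> real"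
    and \<mu> C :: real and r :: "real \<Rightarrow> real"
  assumes "DIM('a) \<ge> 2"
    and "open \<Omega>" "connected \<Omega>" "bounded \<Omega>" "\<Omega> \<noteq> {}" "smooth_boundary \<Omega>"
    and "\<not> neumann_eigenvalue \<Omega> (- (k\<^sup>2))"
    and "neumann_green \<Omega> k G"
    and "\<And>s. s \<in> frontier \<Omega> \<Longrightarrow> neumann_solution \<Omega> (- (k\<^sup>2)) (g s) (\<lambda>x. u\<^sub>0 x s)"
    and "u\<^sub>0 \<in> C_space (closure \<Omega>) (frontier \<Omega>)"
    and "\<exists>x\<in>closure \<Omega>. \<exists>s\<in>frontier \<Omega>. u\<^sub>0 x s \<noteq> 0"
    and "bounded_linear_C_Linf \<Omega> \<K>\<^sub>1"
    and "\<mu> = k\<^sup>2 * (SUP x\<in>\<Omega>. LINT y|lebesgue_on \<Omega>. \<bar>G x y\<bar>)"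
    and "C = max 2 (81 / 8 * \<mu> * op_norm \<Omega> \<K>\<^sub>1 * sup_norm (closure \<Omega>) (frontier \<Omega>) u\<^sub>0 ^ 3)"
    and "\<And>\<gamma>. r \<gamma> =
           2 / (27 * \<mu> * (sup_norm (closure \<Omega>) (frontier \<Omega>) (\<lambda>x s. \<gamma> * u\<^sub>0 x s))\<^sup>2)
             * (sqrt (16 * C\<^sup>2 + 1) - 4 * C)"
  shows
    "(\<forall>\<gamma>>0.
        (\<forall>s\<in>frontier \<Omega>.
           neumann_solution \<Omega> (- (k\<^sup>2)) (\<lambda>x. \<gamma> * g s x) (\<lambda>x. \<gamma> * u\<^sub>0 x s)) \<and>
        (\<forall>\<beta>\<in>Linf \<Omega>. \<forall>x\<in>closure \<Omega>. \<forall>s\<in>frontier \<Omega>.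
           forward_op \<Omega> k G (\<lambda>x s. \<gamma> * u\<^sub>0 x s) 1 [\<beta>] x s
             = \<gamma> ^ 3 * forward_op \<Omega> k G u\<^sub>0 1 [\<beta>] x s) \<and>
        81 / 8 * \<mu> * op_norm \<Omega> (\<lambda>\<phi> y. \<K>\<^sub>1 \<phi> y / \<gamma> ^ 3)
            * sup_norm (closure \<Omega>) (frontier \<Omega>) (\<lambda>x s. \<gamma> * u\<^sub>0 x s) ^ 3
          = 81 / 8 * \<mu> * op_norm \<Omega> \<K>\<^sub>1 * sup_norm (closure \<Omega>) (frontier \<Omega>) u\<^sub>0 ^ 3 \<and>
        (\<forall>\<phi>\<in>C_space (frontier \<Omega>) (frontier \<Omega>).
           Linf_norm \<Omega> (\<lambda>y. \<K>\<^sub>1 \<phi> y / \<gamma> ^ 3) < r \<gamma> \<longrightarrow>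
           series_converges_Linf \<Omega>
             (\<lambda>m. inverse_op (forward_op \<Omega> k G (\<lambda>x s. \<gamma> * u\<^sub>0 x s))
                     (\<lambda>\<phi> y. \<K>\<^sub>1 \<phi> y / \<gamma> ^ 3) m \<phi>))) \<and>
     filterlim r at_top (at_right 0)"
proof -
  interpret weakly_singular_kernel \<Omega> G
    using assms(2,4,5,8) by unfold_locales (auto simp: neumann_green_def)
  let ?n = "sup_norm (closure \<Omega>) (frontier \<Omega>)"
  let ?U = "?n u\<^sub>0"
  note u = \<open>u\<^sub>0 \<in> C_space (closure \<Omega>) (frontier \<Omega>)\<close>
  note A = \<open>bounded_linear_C_Linf \<Omega> \<K>\<^sub>1\<close>
  have "k \<noteq> 0"
    using neumann_eigenvalue_0[OF nonempty \<open>smooth_boundary \<Omega>\<close>] assms(7) by auto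
  then have \<mu>: "\<mu> > 0" using kernel_L1_pos[OF assms(8)] by (simp add: assms(13))
  have U: "?U > 0"
  proof -
    obtain x s where "x \<in> closure \<Omega>" "s \<in> frontier \<Omega>" "u\<^sub>0 x s \<noteq> 0" using assms(11) by blast
    then show ?thesis
      using sup_norm_upper[OF compact_closure_domain compact_frontier_domain u, of x s] by auto
  qed
  have U\<gamma>: "?n (\<lambda>x s. \<gamma> * u\<^sub>0 x s) = \<gamma> * ?U" if "\<gamma> > 0" for \<gamma>
    using that nonempty
    by (intro sup_norm_cmult compact_closure_domain compact_frontier_domain u frontier_nonempty) auto
  have A\<gamma>: "op_norm \<Omega> (\<lambda>\<phi> y. \<K>\<^sub>1 \<phi> y / \<gamma> ^ 3) = op_norm \<Omega> \<K>\<^sub>1 / \<gamma> ^ 3" if "\<gamma> > 0" for \<gamma>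
    using op_norm_cmult[OF A, of "1 / \<gamma> ^ 3"] that by simp
  have inv: "81 / 8 * \<mu> * op_norm \<Omega> (\<lambda>\<phi> y. \<K>\<^sub>1 \<phi> y / \<gamma> ^ 3) * ?n (\<lambda>x s. \<gamma> * u\<^sub>0 x s) ^ 3
      = 81 / 8 * \<mu> * op_norm \<Omega> \<K>\<^sub>1 * ?U ^ 3" if "\<gamma> > 0" for \<gamma>
    using that by (simp add: U\<gamma> A\<gamma> power_mult_distrib)
  have conv: "series_converges_Linf \<Omega> (\<lambda>m. inverse_op (forward_op \<Omega> k G (\<lambda>x s. \<gamma> * u\<^sub>0 x s))
      (\<lambda>\<phi> y. \<K>\<^sub>1 \<phi> y / \<gamma> ^ 3) m \<phi>)"
    if \<gamma>: "\<gamma> > 0" and \<phi>: "\<phi> \<in> C_space (frontier \<Omega>) (frontier \<Omega>)"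
      and small: "Linf_norm \<Omega> (\<lambda>y. \<K>\<^sub>1 \<phi> y / \<gamma> ^ 3) < r \<gamma>" for \<gamma> \<phi>
  proof -
    let ?u = "\<lambda>x s. \<gamma> * u\<^sub>0 x s" and ?A = "\<lambda>\<phi> y. \<K>\<^sub>1 \<phi> y / \<gamma> ^ 3"
    let ?\<nu> = "3 / 2 * ?n ?u" and ?\<kappa> = "27 / 4 * \<mu> * (?n ?u)\<^sup>2"
    have u\<gamma>: "?u \<in> C_space (closure \<Omega>) (frontier \<Omega>)" by (rule C_space_cmult[OF u])
    have n: "?n ?u > 0" using U \<gamma> by (simp add: U\<gamma>)
    show ?thesis
    proof (rule inverse_series_converges[where \<nu> = ?\<nu> and \<kappa> = ?\<kappa> and C = C, OF _ \<phi>])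
      show "bounded_linear_C_Linf \<Omega> ?A"
        using bounded_linear_C_Linf_cmult[OF A, of "1 / \<gamma> ^ 3"] by simp
      show "forward_op \<Omega> k G ?u n \<beta>s \<in> C_space (frontier \<Omega>) (frontier \<Omega>) \<and>
          sup_norm (frontier \<Omega>) (frontier \<Omega>) (forward_op \<Omega> k G ?u n \<beta>s)
            \<le> ?\<nu> * ?\<kappa> ^ n * (\<Prod>\<beta>\<leftarrow>\<beta>s. Linf_norm \<Omega> \<beta>)"
        if "length \<beta>s = n" "set \<beta>s \<subseteq> Linf \<Omega>" for n \<beta>s
        using forward_op_geometric[OF u\<gamma> _ that, of k] \<mu> by (simp add: assms(13))
      show "?\<kappa> > 0" "?\<nu> \<ge> 0" using \<mu> n by auto
      have "op_norm \<Omega> ?A * ?\<nu> * ?\<kappa> = 81 / 8 * \<mu> * op_norm \<Omega> ?A * ?n ?u ^ 3"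
        by (simp add: power2_eq_square power3_eq_cube)
      also note inv[OF \<gamma>]
      finally have M: "op_norm \<Omega> ?A * ?\<nu> * ?\<kappa> = 81 / 8 * \<mu> * op_norm \<Omega> \<K>\<^sub>1 * ?U ^ 3" .
      show "C = max 2 (op_norm \<Omega> ?A * ?\<nu> * ?\<kappa>)" unfolding M by (rule assms(14))
      show "Linf_norm \<Omega> (?A \<phi>) < 1 / (2 * ?\<kappa>) * (sqrt (16 * C\<^sup>2 + 1) - 4 * C)"
        using small by (simp add: assms(15))
    qed
  qed
  have lim: "filterlim r at_top (at_right 0)"
  proof -
    define c where "c = 2 / (27 * \<mu> * ?U\<^sup>2) * (sqrt (16 * C\<^sup>2 + 1) - 4 * C)"
    have "C \<ge> 2" by (simp add: assms(14))
    then have "4 * C < sqrt (16 * C\<^sup>2 + 1)"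
      by (intro real_less_rsqrt) (simp add: power_mult_distrib)
    then have c: "c > 0" using \<mu> U by (simp add: c_def)
    have "filterlim (\<lambda>\<gamma>::real. c * (inverse \<gamma>)\<^sup>2) at_top (at_right 0)"
      using filterlim_inverse_at_top_right
      by (intro filterlim_tendsto_pos_mult_at_top[OF tendsto_const c] filterlim_pow_at_top) auto
    moreover have "\<forall>\<^sub>F \<gamma> in at_right 0. r \<gamma> = c * (inverse \<gamma>)\<^sup>2"
      using eventually_at_right_less[of "0::real"]
    proof eventually_elim
      case (elim \<gamma>)
      then show ?case
        unfolding assms(15) U\<gamma>[OF elim] c_def by (simp add: power_mult_distrib field_simps)
    qed
    ultimately show ?thesis by (subst filterlim_cong[OF refl refl])
  qed
  show ?thesis
  proof (intro conjI allI ballI impI lim)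
    show "neumann_solution \<Omega> (- (k\<^sup>2)) (\<lambda>x. \<gamma> * g s x) (\<lambda>x. \<gamma> * u\<^sub>0 x s)"
      if "s \<in> frontier \<Omega>" for \<gamma> s
      by (rule neumann_solution_scale[OF open_domain assms(9)[OF that]])
  qed (rule forward_op_1_cmult inv conv; assumption)+
qed

end
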